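(* Let $B_4$ be the braid group on four strands. The following are equivalent: (i) the Jones representation of $B_4$ is faithful; (ii) the Temperley-Lieb representation of $B_4$ is faithful; (iii) the Burau representation of $B_4$ is faithful.
   Context: $B_n$ is the braid group with standard generators $\sigma_1,\dots,\sigma_{n-1}$ and relations $\sigma_i\sigma_{i+1}\sigma_i=\sigma_{i+1}\sigma_i\sigma_{i+1}$ and $\sigma_i\sigma_j=\sigma_j\sigma_i$ for $|i-j|\ge 2$. Throughout, $q$ is an indeterminate, and a representation is faithful if it is injective on the group. Burau representation of $B_4$: the homomorphism $B_4\to GL_3(\mathbf{Z}[q^{\pm1}])$ given by $$\sigma_1\mapsto\left(\begin{array}{ccc}-q&q&0\\0&1&0\\0&0&1\end{array}\right),\quad \sigma_2\mapsto\left(\begin{array}{ccc}1&0&0\\1&-q&q\\0&0&1\end{array}\right),\quad \sigma_3\mapsto\left(\begin{array}{ccc}1&0&0\\0&1&0\\0&1&-q\end{array}\right).$$ Jones representation of $B_n$: the homomorphism $\sigma_i\mapsto g_i$ from $B_n$ to the group of units of the Hecke algebra $H(q,n)$ of type $A_{n-1}$ over $\mathbf{Q}(q)$. Here $H(q,n)$ is the unital associative algebra with generators $g_1,\dots,g_{n-1}$ subject to the braid relations and $(g_i-1)(g_i+q)=0$. It decomposes into irreducible summands $V_\lambda$, one isomorphism type for each Young diagram $\lambda$ with $n$ boxes, with conventions such that $V_{(n)}$ is the one-dimensional representation $\sigma_i\mapsto 1$ and, for $n=4$, $V_{(3,1)}$ is the Burau representation. Temperley-Lieb representation of $B_n$: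 the sum of those $V_\lambda$ for which $\lambda$ has one or two rows. Equivalently (for $n\geq 3$), it is the composite of the Jones representation with the quotient map from $H(q,n)$ to the Temperley-Lieb algebra, i.e. the quotient of $H(q,n)$ by the two-sided ideal generated by $1-g_1-g_2+g_1g_2+g_2g_1-g_1g_2g_1$. *)

theory Defs
  imports
    "HOL-Algebra.QuotRing"
    "HOL-Analysis.Cartesian_Space"
    "HOL-Library.Poly_Mapping"
    "HOL-Computational_Algebra.Polynomial"
    "HOL-Computational_Algebra.Fraction_Field"
begin

section \<open>Groups given by generators and relations\<close>

text \<open>A letter \<open>(s, True)\<close> stands for the generator \<open>s\<close> and \<open>(s, False)\<close> for its inverse.\<close>

definition group_words :: "'s set \<Rightarrow> ('s \<times> bool) list set" where
  "group_words S = lists (S \<times> UNIV)"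

inductive_set group_cong ::
    "'s set \<Rightarrow> (('s \<times> bool) list \<times> ('s \<times> bool) list) set
      \<Rightarrow> (('s \<times> bool) list \<times> ('s \<times> bool) list) set"
  for S R where
  refl: "w \<in> group_words S \<Longrightarrow> (w, w) \<in> group_cong S R"
| sym: "(u, v) \<in> group_cong S R \<Longrightarrow> (v, u) \<in> group_cong S R"
| trans: "(u, v) \<in> group_cong S R \<Longrightarrow> (v, w) \<in> group_cong S R \<Longrightarrow> (u, w) \<in> group_cong S R"
| relation: "(u, v) \<in> R \<Longrightarrow> u \<in> group_words S \<Longrightarrow> v \<in> group_words S
    \<Longrightarrow> a \<in> group_words S \<Longrightarrow> b \<in> group_words S
    \<Longrightarrow> (a @ u @ b, a @ v @ b) \<in> group_cong S R"
| cancel: "s \<in> S \<Longrightarrow> a \<in> group_words S \<Longrightarrow> b \<in> group_words S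
    \<Longrightarrow> (a @ [(s, e), (s, \<not> e)] @ b, a @ b) \<in> group_cong S R"

definition presented_group ::
    "'s set \<Rightarrow> (('s \<times> bool) list \<times> ('s \<times> bool) list) set \<Rightarrow> ('s \<times> bool) list set monoid" where
  "presented_group S R =
     \<lparr>carrier = group_words S // group_cong S R,
      Group.monoid.mult = (\<lambda>X Y. \<Union>x\<in>X. \<Union>y\<in>Y. group_cong S R `` {x @ y}),
      one = group_cong S R `` {[]}\<rparr>"

definition presented_gen ::
    "'s set \<Rightarrow> (('s \<times> bool) list \<times> ('s \<times> bool) list) set \<Rightarrow> 's \<Rightarrow> ('s \<times> bool) list set" where
  "presented_gen S R s = group_cong S R `` {[(s, True)]}"

definition word_eval :: "('g, 'm) monoid_scheme \<Rightarrow> ('s \<Rightarrow> 'g) \<Rightarrow> ('s \<times> bool) list \<Rightarrow> 'g" where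
  "word_eval H f w =
     foldr (\<lambda>(s, e) g. (if e then f s else inv\<^bsub>H\<^esub> f s) \<otimes>\<^bsub>H\<^esub> g) w \<one>\<^bsub>H\<^esub>"

text \<open>The homomorphism out of a presented group that sends each generator \<open>s\<close> to \<open>f s\<close>.
  It is meaningful when \<open>f\<close> respects the relations, see \<open>presented_lift_hom\<close> below.\<close>

definition presented_lift ::
    "('g, 'm) monoid_scheme \<Rightarrow> ('s \<Rightarrow> 'g) \<Rightarrow> ('s \<times> bool) list set \<Rightarrow> 'g" where
  "presented_lift H f X = the_elem (word_eval H f ` X)"

lemma group_words_simps [simp]:
  "[] \<in> group_words S"
  "x # w \<in> group_words S \<longleftrightarrow> fst x \<in> S \<and> w \<in> group_words S"
  "u @ v \<in> group_words S \<longleftrightarrow> u \<in> group_words S \<and> v \<in> group_words S"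
  by (cases x; auto simp: group_words_def)+

lemma group_cong_words:
  "(u, v) \<in> group_cong S R \<Longrightarrow> u \<in> group_words S \<and> v \<in> group_words S"
  by (induction rule: group_cong.induct) auto

lemma equiv_group_cong: "equiv (group_words S) (group_cong S R)"
proof (rule equivI)
  show "group_cong S R \<subseteq> group_words S \<times> group_words S"
    using group_cong_words by auto
  show "refl_on (group_words S) (group_cong S R)"
    by (rule refl_onI) (rule group_cong.refl)
  show "Relation.sym (group_cong S R)"
    by (rule symI) (rule group_cong.sym)
  show "Relation.trans (group_cong S R)"
    by (rule transI) (rule group_cong.trans)
qed

lemma group_cong_ctxt:
  assumes "(u, v) \<in> group_cong S R" "a \<in> group_words S" "b \<in> group_words S"
  shows "(a @ u @ b, a @ v @ b) \<in> group_cong S R"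
  using assms(1)
proof (induction rule: group_cong.induct)
  case (refl w)
  then show ?case by (intro group_cong.refl) (simp add: assms)
next
  case (sym u v)
  then show ?case by (blast intro: group_cong.sym)
next
  case (trans u v w)
  then show ?case by (blast intro: group_cong.trans)
next
  case (relation u v c d)
  then show ?case
    using group_cong.relation[of u v R S "a @ c" "d @ b"] assms by simp
next
  case (cancel s c d e)
  then show ?case
    using group_cong.cancel[of s S "a @ c" "d @ b" e] assms by simp
qed

lemma group_cong_append:
  assumes "(u, u') \<in> group_cong S R" "(v, v') \<in> group_cong S R"
  shows "(u @ v, u' @ v') \<in> group_cong S R"
proof (rule group_cong.trans)
  show "(u @ v, u' @ v) \<in> group_cong S R"
    using group_cong_ctxt[OF assms(1), of "[]" v] group_cong_words[OF assms(2)] by simp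
  show "(u' @ v, u' @ v') \<in> group_cong S R"
    using group_cong_ctxt[OF assms(2), of u' "[]"] group_cong_words[OF assms(1)] by simp
qed

lemma group_cong_class_eq:
  "(u, v) \<in> group_cong S R \<Longrightarrow> group_cong S R `` {u} = group_cong S R `` {v}"
  by (rule equiv_class_eq[OF equiv_group_cong])

lemma presented_mult:
  assumes "u \<in> group_words S" "v \<in> group_words S"
  shows "group_cong S R `` {u} \<otimes>\<^bsub>presented_group S R\<^esub> group_cong S R `` {v}
    = group_cong S R `` {u @ v}"
proof -
  let ?C = "\<lambda>w. group_cong S R `` {w}"
  have "?C (x @ y) = ?C (u @ v)" if "x \<in> ?C u" "y \<in> ?C v" for x y
    using that group_cong_class_eq[OF group_cong_append] by blast
  then have "(\<Union>x\<in>?C u. \<Union>y\<in>?C v. ?C (x @ y)) = (\<Union>x\<in>?C u. \<Union>y\<in>?C v. ?C (u @ v))"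
    by (intro SUP_cong HOL.refl)
  also have "u \<in> ?C u" "v \<in> ?C v"
    using assms by (simp_all add: group_cong.refl)
  then have "(\<Union>x\<in>?C u. \<Union>y\<in>?C v. ?C (u @ v)) = ?C (u @ v)"
    by blast
  finally show ?thesis
    by (simp add: presented_group_def)
qed

lemma presented_carrierE:
  assumes "X \<in> carrier (presented_group S R)"
  obtains w where "w \<in> group_words S" "X = group_cong S R `` {w}"
  using assms by (auto simp: presented_group_def quotient_def)

lemma presented_carrierI:
  "w \<in> group_words S \<Longrightarrow> group_cong S R `` {w} \<in> carrier (presented_group S R)"
  by (auto simp: presented_group_def quotient_def)

lemma presented_inverse_word:
  "w \<in> group_words S \<Longrightarrow> \<exists>w'\<in>group_words S. (w' @ w, []) \<in> group_cong S R"
proof (induction w)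
  case Nil
  show ?case by (rule bexI[of _ "[]"]) (simp_all add: group_cong.refl)
next
  case (Cons x w)
  then obtain w' where w': "w' \<in> group_words S" "(w' @ w, []) \<in> group_cong S R" by auto
  obtain s e where x: "x = (s, e)" by (cases x)
  have "(w' @ [(s, \<not> e), (s, \<not> \<not> e)] @ w, w' @ w) \<in> group_cong S R"
    using Cons.prems w' x by (intro group_cong.cancel) auto
  from group_cong.trans[OF this w'(2)]
  have "((w' @ [(s, \<not> e)]) @ x # w, []) \<in> group_cong S R"
    using x by simp
  then show ?case
    using w' x Cons.prems by (intro bexI[of _ "w' @ [(s, \<not> e)]"]) auto
qed

lemma presented_group_is_group: "group (presented_group S R)"
proof (rule groupI)
  have one: "\<one>\<^bsub>presented_group S R\<^esub> = group_cong S R `` {[]}"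
    by (simp add: presented_group_def)
  show "\<one>\<^bsub>presented_group S R\<^esub> \<in> carrier (presented_group S R)"
    by (simp add: one presented_carrierI)
  fix X assume X: "X \<in> carrier (presented_group S R)"
  then obtain x where x: "x \<in> group_words S" "X = group_cong S R `` {x}"
    by (rule presented_carrierE)
  show "\<one>\<^bsub>presented_group S R\<^esub> \<otimes>\<^bsub>presented_group S R\<^esub> X = X"
    using x by (simp add: one presented_mult)
  obtain x' where x': "x' \<in> group_words S" "(x' @ x, []) \<in> group_cong S R"
    using presented_inverse_word[OF x(1)] by blast
  show "\<exists>Y\<in>carrier (presented_group S R). Y \<otimes>\<^bsub>presented_group S R\<^esub> X = \<one>\<^bsub>presented_group S R\<^esub>"
    using x x' group_cong_class_eq[OF x'(2)]
    by (intro bexI[of _ "group_cong S R `` {x'}"])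
      (simp_all add: one presented_mult presented_carrierI)
  fix Y assume "Y \<in> carrier (presented_group S R)"
  then obtain y where y: "y \<in> group_words S" "Y = group_cong S R `` {y}"
    by (rule presented_carrierE)
  show "X \<otimes>\<^bsub>presented_group S R\<^esub> Y \<in> carrier (presented_group S R)"
    using x y by (simp add: presented_mult presented_carrierI)
  fix Z assume "Z \<in> carrier (presented_group S R)"
  then obtain z where z: "z \<in> group_words S" "Z = group_cong S R `` {z}"
    by (rule presented_carrierE)
  show "X \<otimes>\<^bsub>presented_group S R\<^esub> Y \<otimes>\<^bsub>presented_group S R\<^esub> Z
      = X \<otimes>\<^bsub>presented_group S R\<^esub> (Y \<otimes>\<^bsub>presented_group S R\<^esub> Z)"
    using x y z by (simp add: presented_mult)
qed

context
  fixes H :: "('g, 'm) monoid_scheme" and f :: "'s \<Rightarrow> 'g" and S :: "'s set"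
    and R :: "(('s \<times> bool) list \<times> ('s \<times> bool) list) set"
  assumes H: "group H" and f: "\<And>s. s \<in> S \<Longrightarrow> f s \<in> carrier H"
begin

interpretation group H by (fact H)

lemma word_eval_closed: "w \<in> group_words S \<Longrightarrow> word_eval H f w \<in> carrier H"
  by (induction w) (auto simp: word_eval_def f)

lemma word_eval_append:
  "u \<in> group_words S \<Longrightarrow> v \<in> group_words S
    \<Longrightarrow> word_eval H f (u @ v) = word_eval H f u \<otimes>\<^bsub>H\<^esub> word_eval H f v"
proof (induction u)
  case Nil
  then show ?case using word_eval_closed[of v] by (simp add: word_eval_def)
next
  case (Cons x u)
  then show ?case
    using word_eval_closed[of u] word_eval_closed[of v] f[of "fst x"]
    by (cases x) (auto simp: word_eval_def m_assoc)
qed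

context
  assumes rel: "\<And>u v. (u, v) \<in> R \<Longrightarrow> word_eval H f u = word_eval H f v"
begin

lemma word_eval_cong: "(u, v) \<in> group_cong S R \<Longrightarrow> word_eval H f u = word_eval H f v"
proof (induction rule: group_cong.induct)
  case (relation u v a b)
  then show ?case by (simp add: word_eval_append rel)
next
  case (cancel s a b e)
  have "word_eval H f [(s, e), (s, \<not> e)] = \<one>\<^bsub>H\<^esub>"
    using f[OF cancel(1)] by (auto simp: word_eval_def)
  then show ?case
    using cancel word_eval_append[of a "[(s, e), (s, \<not> e)] @ b"]
      word_eval_append[of "[(s, e), (s, \<not> e)]" b]
    by (simp add: word_eval_append word_eval_closed)
qed auto

lemma presented_lift_class:
  assumes "w \<in> group_words S"
  shows "presented_lift H f (group_cong S R `` {w}) = word_eval H f w"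
proof -
  have "word_eval H f ` (group_cong S R `` {w}) = {word_eval H f w}" (is "?L = _")
  proof (intro equalityI subsetI)
    fix g assume "g \<in> ?L"
    then obtain v where "(w, v) \<in> group_cong S R" "g = word_eval H f v" by blast
    then show "g \<in> {word_eval H f w}" by (simp only: word_eval_cong[of w v] singleton_iff)
  next
    fix g assume "g \<in> {word_eval H f w}"
    then show "g \<in> ?L" using group_cong.refl[OF assms, of R] by blast
  qed
  then show ?thesis by (simp add: presented_lift_def)
qed

lemma presented_lift_hom: "presented_lift H f \<in> hom (presented_group S R) H"
proof (rule homI)
  fix X assume "X \<in> carrier (presented_group S R)"
  then show "presented_lift H f X \<in> carrier H"
    by (elim presented_carrierE) (simp add: presented_lift_class word_eval_closed)
next
  fix X Y assume "X \<in> carrier (presented_group S R)" "Y \<in> carrier (presented_group S R)"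
  then show "presented_lift H f (X \<otimes>\<^bsub>presented_group S R\<^esub> Y)
      = presented_lift H f X \<otimes>\<^bsub>H\<^esub> presented_lift H f Y"
    by (elim presented_carrierE) (simp add: presented_mult presented_lift_class word_eval_append)
qed

lemma presented_lift_gen: "s \<in> S \<Longrightarrow> presented_lift H f (presented_gen S R s) = f s"
  using f[of s] by (simp add: presented_gen_def presented_lift_class) (simp add: word_eval_def)

end

end


section \<open>The braid group\<close>

text \<open>The index \<open>i\<close> stands for the generator \<open>\<sigma>\<^sub>i\<close> (or \<open>g\<^sub>i\<close> in the Hecke algebra), where \<open>1 \<le> i < n\<close>.\<close>

definition braid_relations :: "nat \<Rightarrow> (nat list \<times> nat list) set" where
  "braid_relations n =
     {([i, i + 1, i], [i + 1, i, i + 1]) | i. 1 \<le> i \<and> i + 1 < n} \<union>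
     {([i, j], [j, i]) | i j. i \<in> {1..<n} \<and> j \<in> {1..<n} \<and> \<bar>int i - int j\<bar> \<ge> 2}"

definition braid_group_relations :: "nat \<Rightarrow> ((nat \<times> bool) list \<times> (nat \<times> bool) list) set" where
  "braid_group_relations n =
     {(map (\<lambda>i. (i, True)) u, map (\<lambda>i. (i, True)) v) | u v. (u, v) \<in> braid_relations n}"

definition braid_group :: "nat \<Rightarrow> (nat \<times> bool) list set monoid" where
  "braid_group n = presented_group {1..<n} (braid_group_relations n)"

definition braid_gen :: "nat \<Rightarrow> nat \<Rightarrow> (nat \<times> bool) list set" where
  "braid_gen n = presented_gen {1..<n} (braid_group_relations n)"

lemma braid_group_is_group: "group (braid_group n)"
  unfolding braid_group_def by (rule presented_group_is_group)

lemma braid_lift: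
  assumes "group H" "\<And>i. i \<in> {1..<n} \<Longrightarrow> f i \<in> carrier H"
    and "\<And>i. 1 \<le> i \<Longrightarrow> i + 1 < n
      \<Longrightarrow> f i \<otimes>\<^bsub>H\<^esub> (f (i + 1) \<otimes>\<^bsub>H\<^esub> f i) = f (i + 1) \<otimes>\<^bsub>H\<^esub> (f i \<otimes>\<^bsub>H\<^esub> f (i + 1))"
    and "\<And>i j. i \<in> {1..<n} \<Longrightarrow> j \<in> {1..<n} \<Longrightarrow> \<bar>int i - int j\<bar> \<ge> 2
      \<Longrightarrow> f i \<otimes>\<^bsub>H\<^esub> f j = f j \<otimes>\<^bsub>H\<^esub> f i"
  shows "presented_lift H f \<in> hom (braid_group n) H"
    and "\<And>i. i \<in> {1..<n} \<Longrightarrow> presented_lift H f (braid_gen n i) = f i"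
proof -
  interpret group H by fact
  have *: "word_eval H f u = word_eval H f v" if "(u, v) \<in> braid_group_relations n" for u v
  proof -
    from that consider
      (braid) i where "1 \<le> i" "i + 1 < n"
        "u = [(i, True), (i + 1, True), (i, True)]" "v = [(i + 1, True), (i, True), (i + 1, True)]"
    | (comm) i j where "i \<in> {1..<n}" "j \<in> {1..<n}" "\<bar>int i - int j\<bar> \<ge> 2"
        "u = [(i, True), (j, True)]" "v = [(j, True), (i, True)]"
      by (auto simp: braid_group_relations_def braid_relations_def)
    then show ?thesis
    proof cases
      case braid
      then have "f i \<in> carrier H" "f (i + 1) \<in> carrier H" using assms(2) by simp_all
      then show ?thesis using assms(3)[OF braid(1,2)] braid(3,4) by (simp add: word_eval_def)
    next
      case comm
      then have "f i \<in> carrier H" "f j \<in> carrier H" using assms(2) by simp_all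
      then show ?thesis using assms(4)[OF comm(1-3)] comm(4,5) by (simp add: word_eval_def)
    qed
  qed
  show "presented_lift H f \<in> hom (braid_group n) H"
    unfolding braid_group_def
    by (rule presented_lift_hom) (fact assms(1), erule assms(2), erule *)
  show "presented_lift H f (braid_gen n i) = f i" if "i \<in> {1..<n}" for i
    unfolding braid_gen_def
    by (rule presented_lift_gen[where S = "{1..<n}"]) (fact assms(1), erule assms(2), erule *, fact that)
qed


section \<open>The Burau representation of \<open>B\<^sub>4\<close>\<close>

text \<open>Finitely supported functions \<open>int \<Rightarrow> int\<close> with convolution: the ring of integer Laurent
  polynomials in \<open>q\<close>.\<close>

type_synonym laurent = "int \<Rightarrow>\<^sub>0 int"

definition laurent_q :: laurent where
  "laurent_q = Poly_Mapping.single 1 1"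

definition GL :: "'a::comm_ring_1 itself \<Rightarrow> 'n::finite itself \<Rightarrow> ('a ^ 'n ^ 'n) monoid" where
  "GL _ _ = \<lparr>carrier = {A. invertible A}, Group.monoid.mult = (**), one = mat 1\<rparr>"

definition burau_matrix :: "nat \<Rightarrow> laurent ^ 3 ^ 3" where
  "burau_matrix i = (let q = laurent_q in
     if i = 1 then vector [vector [- q, q, 0], vector [0, 1, 0], vector [0, 0, 1]]
     else if i = 2 then vector [vector [1, 0, 0], vector [1, - q, q], vector [0, 0, 1]]
     else vector [vector [1, 0, 0], vector [0, 1, 0], vector [0, 1, - q]])"

definition burau_rep :: "(nat \<times> bool) list set \<Rightarrow> laurent ^ 3 ^ 3" where
  "burau_rep = presented_lift (GL TYPE(laurent) TYPE(3)) burau_matrix"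


section \<open>The Hecke algebra and the Jones representation\<close>

text \<open>With concatenation as addition, words form a monoid whose convolution algebra of finitely
  supported functions is the free associative algebra.\<close>

instantiation list :: (type) monoid_add
begin

definition zero_list :: "'a list" where "zero_list = []"
definition plus_list :: "'a list \<Rightarrow> 'a list \<Rightarrow> 'a list" where "plus_list = (@)"

instance by standard (auto simp: zero_list_def plus_list_def)

end

definition free_algebra :: "'s set \<Rightarrow> ('s list \<Rightarrow>\<^sub>0 'k::field) ring" where
  "free_algebra S =
     \<lparr>carrier = {p. Poly_Mapping.keys p \<subseteq> lists S}, Group.monoid.mult = (*), one = 1, zero = 0, add = (+)\<rparr>"

definition word_monom :: "'s list \<Rightarrow> ('s list \<Rightarrow>\<^sub>0 'k::field)" where
  "word_monom w = Poly_Mapping.single w 1"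

definition scalar :: "'k::field \<Rightarrow> ('s list \<Rightarrow>\<^sub>0 'k)" where
  "scalar c = Poly_Mapping.single [] c"

type_synonym ratfun = "rat poly fract"

definition ratfun_q :: ratfun where
  "ratfun_q = Fract [:0, 1:] 1"

definition hecke_relators :: "nat \<Rightarrow> (nat list \<Rightarrow>\<^sub>0 ratfun) set" where
  "hecke_relators n =
     {word_monom u - word_monom v | u v. (u, v) \<in> braid_relations n} \<union>
     {(word_monom [i] - 1) * (word_monom [i] + scalar ratfun_q) | i. i \<in> {1..<n}}"

definition hecke_ideal :: "nat \<Rightarrow> (nat list \<Rightarrow>\<^sub>0 ratfun) set" where
  "hecke_ideal n = Idl\<^bsub>free_algebra {1..<n}\<^esub> (hecke_relators n)"

definition hecke_algebra :: "nat \<Rightarrow> (nat list \<Rightarrow>\<^sub>0 ratfun) set ring" where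
  "hecke_algebra n = free_algebra {1..<n} Quot hecke_ideal n"

definition hecke_gen :: "nat \<Rightarrow> nat \<Rightarrow> (nat list \<Rightarrow>\<^sub>0 ratfun) set" where
  "hecke_gen n i = hecke_ideal n +>\<^bsub>free_algebra {1..<n}\<^esub> word_monom [i]"

definition jones_rep :: "nat \<Rightarrow> (nat \<times> bool) list set \<Rightarrow> (nat list \<Rightarrow>\<^sub>0 ratfun) set" where
  "jones_rep n = presented_lift (units_of (hecke_algebra n)) (hecke_gen n)"


section \<open>The Temperley-Lieb representation\<close>

text \<open>With \<open>(g\<^sub>i - 1) (g\<^sub>i + q) = 0\<close> the element below vanishes under \<open>g\<^sub>i \<mapsto> 1\<close>, so that the quotient
  keeps exactly the summands belonging to Young diagrams with at most two rows.
  It involves \<open>g\<^sub>1\<close> and \<open>g\<^sub>2\<close>, hence the Temperley-Lieb notions make sense for \<open>n \<ge> 3\<close>.\<close>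

definition TL_element :: "nat \<Rightarrow> (nat list \<Rightarrow>\<^sub>0 ratfun) set" where
  "TL_element n = (let H = hecke_algebra n; g = hecke_gen n in
     \<one>\<^bsub>H\<^esub> \<ominus>\<^bsub>H\<^esub> g 1 \<ominus>\<^bsub>H\<^esub> g 2 \<oplus>\<^bsub>H\<^esub> g 1 \<otimes>\<^bsub>H\<^esub> g 2 \<oplus>\<^bsub>H\<^esub> g 2 \<otimes>\<^bsub>H\<^esub> g 1
       \<ominus>\<^bsub>H\<^esub> g 1 \<otimes>\<^bsub>H\<^esub> g 2 \<otimes>\<^bsub>H\<^esub> g 1)"

definition TL_ideal :: "nat \<Rightarrow> (nat list \<Rightarrow>\<^sub>0 ratfun) set set" where
  "TL_ideal n = Idl\<^bsub>hecke_algebra n\<^esub> {TL_element n}"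

definition TL_algebra :: "nat \<Rightarrow> (nat list \<Rightarrow>\<^sub>0 ratfun) set set ring" where
  "TL_algebra n = hecke_algebra n Quot TL_ideal n"

definition TL_rep :: "nat \<Rightarrow> (nat \<times> bool) list set \<Rightarrow> (nat list \<Rightarrow>\<^sub>0 ratfun) set set" where
  "TL_rep n = (\<lambda>b. TL_ideal n +>\<^bsub>hecke_algebra n\<^esub> jones_rep n b)"


section \<open>Faithfulness\<close>

text \<open>Injectivity on the group; the maps in question are shown to be homomorphisms below.\<close>

definition faithful :: "('a, 'm) monoid_scheme \<Rightarrow> ('a \<Rightarrow> 'b) \<Rightarrow> bool" where
  "faithful G \<rho> \<longleftrightarrow> inj_on \<rho> (carrier G)"


section \<open>The three maps are homomorphisms with the prescribed values on generators\<close>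

lemma group_GL: "group (GL TYPE('a::comm_ring_1) TYPE('n::finite))"
proof (rule groupI)
  show "\<one>\<^bsub>GL TYPE('a) TYPE('n)\<^esub> \<in> carrier (GL TYPE('a) TYPE('n))"
    by (auto simp: GL_def invertible_def intro: exI[of _ "mat 1"])
  fix A B C :: "'a ^ 'n ^ 'n"
  assume A: "A \<in> carrier (GL TYPE('a) TYPE('n))"
  then obtain A' where A': "A ** A' = mat 1" "A' ** A = mat 1"
    by (auto simp: GL_def invertible_def)
  then show "\<exists>D\<in>carrier (GL TYPE('a) TYPE('n)). D \<otimes>\<^bsub>GL TYPE('a) TYPE('n)\<^esub> A = \<one>\<^bsub>GL TYPE('a) TYPE('n)\<^esub>"
    by (intro bexI[of _ A']) (auto simp: GL_def invertible_def)
  show "\<one>\<^bsub>GL TYPE('a) TYPE('n)\<^esub> \<otimes>\<^bsub>GL TYPE('a) TYPE('n)\<^esub> A = A"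
    by (simp add: GL_def)
  assume "B \<in> carrier (GL TYPE('a) TYPE('n))"
  then obtain B' where B': "B ** B' = mat 1" "B' ** B = mat 1"
    by (auto simp: GL_def invertible_def)
  have "(A ** B) ** (B' ** A') = A ** (B ** B') ** A'" "(B' ** A') ** (A ** B) = B' ** (A' ** A) ** B"
    by (simp_all add: matrix_mul_assoc)
  then show "A \<otimes>\<^bsub>GL TYPE('a) TYPE('n)\<^esub> B \<in> carrier (GL TYPE('a) TYPE('n))"
    using A' B' by (auto simp: GL_def invertible_def intro!: exI[of _ "B' ** A'"])
  show "A \<otimes>\<^bsub>GL TYPE('a) TYPE('n)\<^esub> B \<otimes>\<^bsub>GL TYPE('a) TYPE('n)\<^esub> C
      = A \<otimes>\<^bsub>GL TYPE('a) TYPE('n)\<^esub> (B \<otimes>\<^bsub>GL TYPE('a) TYPE('n)\<^esub> C)"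
    by (simp add: GL_def matrix_mul_assoc)
qed

lemma laurent_q_unit: "laurent_q * Poly_Mapping.single (- 1) 1 = 1"
  by (simp add: laurent_q_def mult_single)

lemma burau_matrix_eqs:
  "burau_matrix 1 ** (burau_matrix 2 ** burau_matrix 1)
     = burau_matrix 2 ** (burau_matrix 1 ** burau_matrix 2)"
  "burau_matrix 2 ** (burau_matrix 3 ** burau_matrix 2)
     = burau_matrix 3 ** (burau_matrix 2 ** burau_matrix 3)"
  "burau_matrix 1 ** burau_matrix 3 = burau_matrix 3 ** burau_matrix 1"
  by (simp_all add: burau_matrix_def Let_def vec_eq_iff forall_3 matrix_matrix_mult_def sum_3
      algebra_simps)

lemma burau_matrix_invertible: "invertible (burau_matrix i)"
proof -
  define r :: laurent where "r = Poly_Mapping.single (- 1) 1"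
  have r: "laurent_q * r = 1" "r * laurent_q = 1"
    using laurent_q_unit by (simp_all add: r_def mult.commute)
  define B :: "laurent ^ 3 ^ 3" where "B =
     (if i = 1 then vector [vector [- r, 1, 0], vector [0, 1, 0], vector [0, 0, 1]]
     else if i = 2 then vector [vector [1, 0, 0], vector [r, - r, 1], vector [0, 0, 1]]
     else vector [vector [1, 0, 0], vector [0, 1, 0], vector [0, r, - r]])"
  have "burau_matrix i ** B = mat 1" "B ** burau_matrix i = mat 1"
    by (simp_all add: B_def burau_matrix_def Let_def vec_eq_iff forall_3 matrix_matrix_mult_def
        sum_3 mat_def r)
  then show ?thesis by (auto simp: invertible_def)
qed

lemma burau_rep_hom: "burau_rep \<in> hom (braid_group 4) (GL TYPE(laurent) TYPE(3))"
  and burau_rep_gen: "i \<in> {1..<4} \<Longrightarrow> burau_rep (braid_gen 4 i) = burau_matrix i"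
proof -
  let ?G = "GL TYPE(laurent) TYPE(3)"
  have c: "burau_matrix i \<in> carrier ?G" for i
    by (simp add: GL_def burau_matrix_invertible)
  have b: "burau_matrix i \<otimes>\<^bsub>?G\<^esub> (burau_matrix (i + 1) \<otimes>\<^bsub>?G\<^esub> burau_matrix i)
      = burau_matrix (i + 1) \<otimes>\<^bsub>?G\<^esub> (burau_matrix i \<otimes>\<^bsub>?G\<^esub> burau_matrix (i + 1))"
    if "1 \<le> i" "i + 1 < 4" for i
  proof -
    from that have "i = 1 \<or> i = 2" by auto
    then show ?thesis using burau_matrix_eqs by (auto simp: GL_def numeral_eq_Suc)
  qed
  have d: "burau_matrix i \<otimes>\<^bsub>?G\<^esub> burau_matrix j = burau_matrix j \<otimes>\<^bsub>?G\<^esub> burau_matrix i"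
    if "i \<in> {1..<4}" "j \<in> {1..<4}" "\<bar>int i - int j\<bar> \<ge> 2" for i j
  proof -
    from that have "i = 1 \<and> j = 3 \<or> i = 3 \<and> j = 1" by auto
    then show ?thesis using burau_matrix_eqs(3) by (auto simp: GL_def)
  qed
  show "burau_rep \<in> hom (braid_group 4) ?G"
    unfolding burau_rep_def by (rule braid_lift(1)[OF group_GL]) (rule c, erule (1) b, erule (2) d)
  show "burau_rep (braid_gen 4 i) = burau_matrix i" if "i \<in> {1..<4}"
    unfolding burau_rep_def by (rule braid_lift(2)[OF group_GL, where n = 4])
      (rule c, erule (1) b, erule (2) d, fact that)
qed

lemma ring_free_algebra: "ring (free_algebra S :: ('s list \<Rightarrow>\<^sub>0 'k::field) ring)"
proof (rule ringI)
  let ?F = "free_algebra S :: ('s list \<Rightarrow>\<^sub>0 'k) ring"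
  have keys_lists_add: "Poly_Mapping.keys (x + y) \<subseteq> lists S"
    if "Poly_Mapping.keys x \<subseteq> lists S" "Poly_Mapping.keys y \<subseteq> lists S" for x y :: "'s list \<Rightarrow>\<^sub>0 'k"
    using that keys_add[of x y] by blast
  show "abelian_group ?F"
  proof (rule abelian_groupI)
    fix x assume "x \<in> carrier ?F"
    then show "\<exists>y\<in>carrier ?F. y \<oplus>\<^bsub>?F\<^esub> x = \<zero>\<^bsub>?F\<^esub>"
      by (intro bexI[of _ "- x"]) (auto simp: free_algebra_def)
  qed (use keys_lists_add in \<open>auto simp: free_algebra_def algebra_simps\<close>)
  show "Group.monoid ?F"
  proof (rule monoidI)
    fix x y assume "x \<in> carrier ?F" "y \<in> carrier ?F"
    then show "x \<otimes>\<^bsub>?F\<^esub> y \<in> carrier ?F"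
      using keys_mult[of x y] by (fastforce simp: free_algebra_def plus_list_def)
  qed (auto simp: free_algebra_def algebra_simps zero_list_def)
qed (auto simp: free_algebra_def algebra_simps)

lemma word_monom_carrier: "w \<in> lists S \<Longrightarrow> word_monom w \<in> carrier (free_algebra S)"
  by (simp add: free_algebra_def word_monom_def)

lemma word_monom_mult: "word_monom u * word_monom v = word_monom (u @ v)"
  by (simp add: word_monom_def mult_single plus_list_def)

lemma scalar_carrier: "scalar c \<in> carrier (free_algebra S)"
  by (auto simp: free_algebra_def scalar_def)

lemma free_algebra_uminus_carrier:
  "p \<in> carrier (free_algebra S) \<Longrightarrow> - p \<in> carrier (free_algebra S)"
  by (simp add: free_algebra_def)

lemma free_algebra_closed:
  assumes "p \<in> carrier (free_algebra S)" "p' \<in> carrier (free_algebra S)"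
  shows "p + p' \<in> carrier (free_algebra S)" "p * p' \<in> carrier (free_algebra S)"
    "p - p' \<in> carrier (free_algebra S)" "1 \<in> carrier (free_algebra S)"
proof -
  interpret ring "free_algebra S" by (rule ring_free_algebra)
  show "p + p' \<in> carrier (free_algebra S)" "p * p' \<in> carrier (free_algebra S)"
    "1 \<in> carrier (free_algebra S)"
    using a_closed[OF assms] m_closed[OF assms] one_closed by (simp_all add: free_algebra_def)
  show "p - p' \<in> carrier (free_algebra S)"
    using a_closed[OF assms(1) free_algebra_uminus_carrier[OF assms(2)]]
    by (simp add: free_algebra_def)
qed

lemma hecke_relators_carrier: "hecke_relators n \<subseteq> carrier (free_algebra {1..<n})"
  unfolding hecke_relators_def braid_relations_def
  by (auto intro!: free_algebra_closed word_monom_carrier scalar_carrier)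

lemma ideal_hecke_ideal: "ideal (hecke_ideal n) (free_algebra {1..<n})"
  unfolding hecke_ideal_def
  by (rule ring.genideal_ideal[OF ring_free_algebra hecke_relators_carrier])

lemma hecke_relators_ideal: "hecke_relators n \<subseteq> hecke_ideal n"
  unfolding hecke_ideal_def
  by (rule ring.genideal_self[OF ring_free_algebra hecke_relators_carrier])

lemma ring_hecke_algebra: "ring (hecke_algebra n)"
  unfolding hecke_algebra_def by (rule ideal.quotient_is_ring[OF ideal_hecke_ideal])

lemma hecke_coset_eq:
  assumes "p \<in> carrier (free_algebra {1..<n})" "p' \<in> carrier (free_algebra {1..<n})"
    and "p - p' \<in> hecke_ideal n"
  shows "hecke_ideal n +>\<^bsub>free_algebra {1..<n}\<^esub> p = hecke_ideal n +>\<^bsub>free_algebra {1..<n}\<^esub> p'"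
proof -
  interpret ideal "hecke_ideal n" "free_algebra {1..<n}" by (rule ideal_hecke_ideal)
  have "p = (p - p') \<oplus>\<^bsub>free_algebra {1..<n}\<^esub> p'" by (simp add: free_algebra_def)
  then have "p \<in> hecke_ideal n +>\<^bsub>free_algebra {1..<n}\<^esub> p'"
    using assms(3) by (auto simp: a_r_coset_def')
  then show ?thesis using a_repr_independence'[of p p'] assms(2) by simp
qed

lemma hecke_mult:
  assumes "p \<in> carrier (free_algebra {1..<n})" "p' \<in> carrier (free_algebra {1..<n})"
  shows "(hecke_ideal n +>\<^bsub>free_algebra {1..<n}\<^esub> p) \<otimes>\<^bsub>hecke_algebra n\<^esub>
      (hecke_ideal n +>\<^bsub>free_algebra {1..<n}\<^esub> p') = hecke_ideal n +>\<^bsub>free_algebra {1..<n}\<^esub> (p * p')"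
  using ideal.rcoset_mult_add[OF ideal_hecke_ideal assms]
  by (simp add: hecke_algebra_def FactRing_def) (simp add: free_algebra_def)

lemma hecke_carrier:
  assumes "p \<in> carrier (free_algebra {1..<n})"
  shows "hecke_ideal n +>\<^bsub>free_algebra {1..<n}\<^esub> p \<in> carrier (hecke_algebra n)"
  using assms by (auto simp: hecke_algebra_def FactRing_def A_RCOSETS_def')

lemma ratfun_q_nonzero: "ratfun_q \<noteq> 0"
  by (simp add: ratfun_q_def Zero_fract_def eq_fract)

lemma scalar_commute: "scalar c * p = p * scalar c"
proof (induction p rule: update_induct)
  case const
  then show ?case by simp
next
  case (update f a b)
  have "Poly_Mapping.update a b f = f + Poly_Mapping.single a b"
    by (rule poly_mapping_eqI)
      (use update in \<open>auto simp: lookup_update lookup_add lookup_single when_def in_keys_iff\<close>)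
  moreover have "scalar c * Poly_Mapping.single a b = Poly_Mapping.single a b * scalar c"
    by (simp add: scalar_def mult_single plus_list_def mult.commute)
  ultimately show ?case using update by (simp add: algebra_simps)
qed

lemma scalar_mult: "scalar c * scalar d = scalar (c * d)"
  by (simp add: scalar_def mult_single plus_list_def)

lemma scalar_one: "scalar 1 = 1"
  unfolding scalar_def zero_list_def[symmetric] by (rule single_one)

lemma hecke_gen_unit:
  assumes "i \<in> {1..<n}"
  shows "hecke_gen n i \<in> Units (hecke_algebra n)"
proof -
  let ?F = "free_algebra {1..<n} :: (nat list \<Rightarrow>\<^sub>0 ratfun) ring"
  let ?I = "hecke_ideal n"
  define x :: "nat list \<Rightarrow>\<^sub>0 ratfun" where "x = word_monom [i]"
  define q r :: "nat list \<Rightarrow>\<^sub>0 ratfun" where "q = scalar ratfun_q" and "r = scalar (inverse ratfun_q)"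
  define y where "y = r * (x - 1 + q)"
  have rq: "r * q = 1"
    using ratfun_q_nonzero by (simp add: r_def q_def scalar_mult scalar_one)
  have x: "x \<in> carrier ?F" and q: "q \<in> carrier ?F" and r: "r \<in> carrier ?F"
    using assms by (auto simp: x_def q_def r_def intro: word_monom_carrier scalar_carrier)
  then have y: "y \<in> carrier ?F" by (auto simp: y_def intro!: free_algebra_closed)
  have rel: "(x - 1) * (x + q) \<in> ?I"
    using assms by (intro subsetD[OF hecke_relators_ideal[of n]]) (auto simp: hecke_relators_def x_def q_def)
  interpret ideal ?I ?F by (rule ideal_hecke_ideal)
  have "r * ((x - 1) * (x + q)) \<in> ?I"
    using I_l_closed[OF rel r] by (simp add: free_algebra_def)
  moreover have "y * x - 1 = r * ((x - 1) * (x + q))" "x * y - 1 = r * ((x - 1) * (x + q))"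
  proof -
    have qx: "q * x = x * q" and rx: "x * r = r * x" for x
      by (simp_all add: q_def r_def scalar_commute)
    have "x * y = r * (x * (x - 1 + q))"
      unfolding y_def by (metis mult.assoc rx)
    then show "x * y - 1 = r * ((x - 1) * (x + q))"
      using rq by (simp add: algebra_simps)
    have "y * x = r * ((x - 1 + q) * x)"
      unfolding y_def by (simp add: mult.assoc)
    then show "y * x - 1 = r * ((x - 1) * (x + q))"
      using rq by (simp add: algebra_simps qx)
  qed
  ultimately have xy: "x * y - 1 \<in> ?I" "y * x - 1 \<in> ?I" by simp_all
  have one: "\<one>\<^bsub>hecke_algebra n\<^esub> = ?I +>\<^bsub>?F\<^esub> 1"
    by (simp add: hecke_algebra_def FactRing_def) (simp add: free_algebra_def)
  have xy_eq: "?I +>\<^bsub>?F\<^esub> (x * y) = ?I +>\<^bsub>?F\<^esub> 1"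
    using hecke_coset_eq[OF _ _ xy(1)] free_algebra_closed[OF x y] by blast
  have yx_eq: "?I +>\<^bsub>?F\<^esub> (y * x) = ?I +>\<^bsub>?F\<^esub> 1"
    using hecke_coset_eq[OF _ _ xy(2)] free_algebra_closed[OF y x] by blast
  have "(?I +>\<^bsub>?F\<^esub> x) \<otimes>\<^bsub>hecke_algebra n\<^esub> (?I +>\<^bsub>?F\<^esub> y) = \<one>\<^bsub>hecke_algebra n\<^esub>"
    "(?I +>\<^bsub>?F\<^esub> y) \<otimes>\<^bsub>hecke_algebra n\<^esub> (?I +>\<^bsub>?F\<^esub> x) = \<one>\<^bsub>hecke_algebra n\<^esub>"
    unfolding hecke_mult[OF x y] hecke_mult[OF y x] one
    by (rule xy_eq yx_eq)+
  then show ?thesis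
    unfolding hecke_gen_def Units_def using hecke_carrier[OF x] hecke_carrier[OF y]
    by (auto simp: x_def)
qed

lemma jones_rep_hom: "jones_rep n \<in> hom (braid_group n) (units_of (hecke_algebra n))"
  and jones_rep_gen: "i \<in> {1..<n} \<Longrightarrow> jones_rep n (braid_gen n i) = hecke_gen n i"
proof -
  let ?H = "units_of (hecke_algebra n)"
  let ?g = "hecke_gen n"
  interpret ring "hecke_algebra n" by (rule ring_hecke_algebra)
  have m: "word_monom w \<in> carrier (free_algebra {1..<n} :: (nat list \<Rightarrow>\<^sub>0 ratfun) ring)"
    if "set w \<subseteq> {1..<n}" for w
    using that by (intro word_monom_carrier) auto
  have e: "hecke_ideal n +>\<^bsub>free_algebra {1..<n}\<^esub> word_monom u
      = hecke_ideal n +>\<^bsub>free_algebra {1..<n}\<^esub> word_monom v" if "(u, v) \<in> braid_relations n" for u v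
  proof (rule hecke_coset_eq)
    show "word_monom u - word_monom v \<in> hecke_ideal n"
      using that hecke_relators_ideal[of n] by (auto simp: hecke_relators_def)
    have "set u \<subseteq> {1..<n}" "set v \<subseteq> {1..<n}" using that by (auto simp: braid_relations_def)
    then show "word_monom u \<in> carrier (free_algebra {1..<n} :: (nat list \<Rightarrow>\<^sub>0 ratfun) ring)"
      "word_monom v \<in> carrier (free_algebra {1..<n} :: (nat list \<Rightarrow>\<^sub>0 ratfun) ring)"
      using m[of u] m[of v] by blast+
  qed
  have b: "?g i \<otimes>\<^bsub>?H\<^esub> (?g (i + 1) \<otimes>\<^bsub>?H\<^esub> ?g i) = ?g (i + 1) \<otimes>\<^bsub>?H\<^esub> (?g i \<otimes>\<^bsub>?H\<^esub> ?g (i + 1))"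
    if "1 \<le> i" "i + 1 < n" for i
  proof -
    have "([i, i + 1, i], [i + 1, i, i + 1]) \<in> braid_relations n"
      using that by (auto simp: braid_relations_def)
    from e[OF this] show ?thesis
      using that by (simp add: units_of_mult hecke_gen_def hecke_mult m word_monom_mult del: One_nat_def)
  qed
  have d: "?g i \<otimes>\<^bsub>?H\<^esub> ?g j = ?g j \<otimes>\<^bsub>?H\<^esub> ?g i"
    if "i \<in> {1..<n}" "j \<in> {1..<n}" "\<bar>int i - int j\<bar> \<ge> 2" for i j
  proof -
    have "([i, j], [j, i]) \<in> braid_relations n" using that by (auto simp: braid_relations_def)
    from e[OF this] show ?thesis
      using that by (simp add: units_of_mult hecke_gen_def hecke_mult m word_monom_mult del: One_nat_def)
  qed
  have c: "?g i \<in> carrier ?H" if "i \<in> {1..<n}" for i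
    using hecke_gen_unit[OF that] by (simp add: units_of_carrier)
  show "jones_rep n \<in> hom (braid_group n) ?H"
    unfolding jones_rep_def by (rule braid_lift(1)[OF units_group]) (erule c, erule (1) b, erule (2) d)
  show "jones_rep n (braid_gen n i) = ?g i" if "i \<in> {1..<n}"
    unfolding jones_rep_def by (rule braid_lift(2)[OF units_group, where n = n])
      (erule c, erule (1) b, erule (2) d, fact that)
qed

lemma TL_element_carrier:
  assumes "3 \<le> n"
  shows "TL_element n \<in> carrier (hecke_algebra n)"
proof -
  interpret ring "hecke_algebra n" by (rule ring_hecke_algebra)
  have "hecke_gen n 1 \<in> carrier (hecke_algebra n)" "hecke_gen n 2 \<in> carrier (hecke_algebra n)"
    using assms by (auto intro!: Units_closed hecke_gen_unit)
  then show ?thesis by (simp add: TL_element_def Let_def)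
qed

lemma ideal_TL_ideal: "3 \<le> n \<Longrightarrow> ideal (TL_ideal n) (hecke_algebra n)"
  unfolding TL_ideal_def
  by (rule ring.genideal_ideal[OF ring_hecke_algebra]) (simp add: TL_element_carrier)

lemma ring_TL_algebra: "3 \<le> n \<Longrightarrow> ring (TL_algebra n)"
  unfolding TL_algebra_def by (rule ideal.quotient_is_ring[OF ideal_TL_ideal])

lemma TL_rep_hom:
  assumes "3 \<le> n"
  shows "TL_rep n \<in> hom (braid_group n) (units_of (TL_algebra n))"
proof -
  interpret ideal "TL_ideal n" "hecke_algebra n" by (rule ideal_TL_ideal[OF assms])
  interpret T: ring "TL_algebra n" by (rule ring_TL_algebra[OF assms])
  let ?\<pi> = "(+>\<^bsub>hecke_algebra n\<^esub>) (TL_ideal n)"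
  have \<pi>: "?\<pi> \<in> ring_hom (hecke_algebra n) (TL_algebra n)"
    unfolding TL_algebra_def by (rule rcos_ring_hom)
  have u: "?\<pi> a \<in> Units (TL_algebra n)" if "a \<in> Units (hecke_algebra n)" for a
  proof -
    let ?b = "inv\<^bsub>hecke_algebra n\<^esub> a"
    have "a \<in> carrier (hecke_algebra n)" "?b \<in> carrier (hecke_algebra n)"
      using that by auto
    then have "?\<pi> a \<otimes>\<^bsub>TL_algebra n\<^esub> ?\<pi> ?b = \<one>\<^bsub>TL_algebra n\<^esub>"
      "?\<pi> ?b \<otimes>\<^bsub>TL_algebra n\<^esub> ?\<pi> a = \<one>\<^bsub>TL_algebra n\<^esub>"
      "?\<pi> a \<in> carrier (TL_algebra n)" "?\<pi> ?b \<in> carrier (TL_algebra n)"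
      using that ring_hom_mult[OF \<pi>, symmetric] ring_hom_one[OF \<pi>] ring_hom_closed[OF \<pi>]
      by simp_all
    then show ?thesis unfolding Units_def by blast
  qed
  have "?\<pi> \<in> hom (units_of (hecke_algebra n)) (units_of (TL_algebra n))"
    by (rule homI)
      (auto simp: units_of_carrier units_of_mult u ring_hom_mult[OF \<pi>] Units_closed)
  from hom_compose[OF jones_rep_hom this] show ?thesis
    by (simp add: TL_rep_def comp_def)
qed

lemma TL_rep_gen:
  "i \<in> {1..<n} \<Longrightarrow> TL_rep n (braid_gen n i) = TL_ideal n +>\<^bsub>hecke_algebra n\<^esub> hecke_gen n i"
  by (simp only: TL_rep_def jones_rep_gen)

end

theory Submission
  imports Defs "HOL-Analysis.Determinants" "HOL-Computational_Algebra.Polynomial_Factorial"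
begin

text \<open>
  Two of the three implications say that a representation factors through another one. The
  Temperley-Lieb representation is by definition a quotient of the Jones representation, and the
  Burau matrices satisfy the Hecke relations and kill the element that generates the
  Temperley-Lieb ideal (\<open>hecke_V31_TL_ideal\<close>), so a braid that is trivial in the Temperley-Lieb
  algebra is trivial under Burau. The integral Burau matrices are recovered from those over
  \<open>\<rat>(q)\<close> because \<open>q\<close> is transcendental (\<open>inj_laurent_eval\<close>).

  The remaining implication, from Jones to Burau, holds because a braid \<open>b\<close> in the kernel of the
  Burau representation \<open>\<rho> = V\<^sub>3\<^sub>1\<close> acts trivially in all five irreducible representations of
  the Hecke algebra. In \<open>V\<^sub>4\<close> every braid is trivial; \<open>V\<^sub>1\<^sub>1\<^sub>1\<^sub>1\<close> is \<open>det \<rho>\<close>, and \<open>V\<^sub>2\<^sub>1\<^sub>1\<close> is the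
  dual of \<open>\<rho>\<close> twisted by \<open>det \<rho>\<close>. The interesting case is the two-dimensional \<open>V\<^sub>2\<^sub>2\<close>
  (\<open>V22_trivial\<close>). At \<open>q = -1\<close> the Burau representation fixes a vector, and the quotient by it is
  \<open>V\<^sub>2\<^sub>2\<close> at \<open>q = -1\<close>, so \<open>V\<^sub>2\<^sub>2(b)\<close> becomes the identity there. In \<open>V\<^sub>2\<^sub>2\<close> the generators
  \<open>\<sigma>\<^sub>1\<close> and \<open>\<sigma>\<^sub>3\<close> agree, so its image is generated by \<open>x = \<sigma>\<^sub>1\<sigma>\<^sub>2\<sigma>\<^sub>1\<close> and \<open>y = \<sigma>\<^sub>1\<sigma>\<^sub>2\<close>, and
  both \<open>x\<^sup>2\<close> and \<open>y\<^sup>3\<close> are the scalar \<open>q\<^sup>3\<close>. Every element is therefore a power of \<open>q\<^sup>3\<close> times an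
  alternating product of \<open>x\<close> with \<open>y\<close> or \<open>y\<^sup>2\<close>. At \<open>q = -1\<close> such products are, up to sign and
  one factor at either end, products of nonnegative unipotent matrices, as in the proof that the
  modular group is a free product of cyclic groups of orders 2 and 3, so only the empty product
  becomes a scalar
  (\<open>normal_form_scalar\<close>). Hence \<open>V\<^sub>2\<^sub>2(b)\<close> is a power of \<open>q\<^sup>3\<close>, and this power is 1 because
  \<open>det V\<^sub>2\<^sub>2(b) = det \<rho>(b) = 1\<close>.

  It remains to see that a braid that is trivial in the five irreducible representations is trivial
  in the Hecke algebra itself (\<open>free_word_trivial\<close>). Up to a nonzero scalar, 1 is a signed sum of
  four products \<open>f = (g\<^sub>1 - \<beta>) (g\<^sub>3 - \<delta>)\<close> with \<open>\<beta>, \<delta> \<in> {1, -q}\<close>, and each \<open>f\<close> is a joint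
  eigenvector of \<open>g\<^sub>1\<close> and \<open>g\<^sub>3\<close>. The left ideal generated by \<open>f\<close> is spanned by six elements on
  which the generators act by explicit matrices, and \<open>f\<close> is a sum of vectors from copies of the
  five representations, given by explicit intertwining matrices. So \<open>b f = f\<close> for all four \<open>f\<close>,
  and therefore \<open>b = 1\<close>.
\<close>

section \<open>Matrix representations on words\<close>

lemma less4_cases:
  assumes "i \<in> {1..<4::nat}"
  obtains "i = 1" | "i = 2" | "i = 3"
  using assms by fastforce

lemma mat_mult_nth: "(mat c ** A) $ i $ j = c * A $ i $ j" for A :: "'a::semiring_1 ^ 'm ^ 'n"
  by (simp add: matrix_matrix_mult_def mat_def if_distrib if_distribR sum.delta' cong: if_cong)

lemma mat_central: "A ** mat c = mat c ** A" for A :: "'a::comm_semiring_1 ^ 'm ^ 'n"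
proof -
  have "(A ** mat c) $ i $ j = c * A $ i $ j" for i j
    by (simp add: matrix_matrix_mult_def mat_def if_distrib if_distribR sum.delta mult.commute
        cong: if_cong)
  then show ?thesis by (simp add: vec_eq_iff mat_mult_nth)
qed

lemma mat_mult_mat: "mat c ** mat d = (mat (c * d) :: 'a::semiring_1 ^ 'n ^ 'n)"
  by (simp add: vec_eq_iff mat_mult_nth) (simp add: mat_def)

lemma matrix_add_mult: "(A + B) ** C = A ** C + B ** C" for C :: "'a::semiring_1 ^ 'm ^ 'n"
  by (simp add: vec_eq_iff matrix_matrix_mult_def sum.distrib distrib_right)

lemma matrix_mult_middle: "(A ** B) ** (C ** D) = A ** ((B ** C) ** D)"
  for A :: "'a::semiring_1 ^ 'm ^ 'n" and B :: "'a ^ 'k ^ 'm" and C :: "'a ^ 'l ^ 'k" and D :: "'a ^ 'o ^ 'l"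
  by (simp add: matrix_mul_assoc)

text \<open>If \<open>M\<close> satisfies \<open>(M - 1) (M + q) = 0\<close> and \<open>r = 1 / q\<close>, then \<open>M\<^sup>-\<^sup>1 = r M + (1 - r)\<close>.
  Taking this as the value on inverse letters makes intertwiners and ring homomorphisms respect
  inverses automatically.\<close>
definition hecke_letter :: "'a::comm_ring_1 \<Rightarrow> (nat \<Rightarrow> 'a ^ 'n ^ 'n) \<Rightarrow> nat \<times> bool \<Rightarrow> 'a ^ 'n ^ 'n" where
  "hecke_letter r M l = (if snd l then M (fst l) else mat r ** M (fst l) + mat (1 - r))"

definition hecke_word :: "'a::comm_ring_1 \<Rightarrow> (nat \<Rightarrow> 'a ^ 'n ^ 'n) \<Rightarrow> (nat \<times> bool) list \<Rightarrow> 'a ^ 'n ^ 'n" where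
  "hecke_word r M w = foldr (\<lambda>l A. hecke_letter r M l ** A) w (mat 1)"

lemma hecke_word_simps [simp]:
  "hecke_word r M [] = mat 1"
  "hecke_word r M (l # w) = hecke_letter r M l ** hecke_word r M w"
  by (simp_all add: hecke_word_def)

lemma hecke_word_intertwine:
  assumes "\<And>i. i \<in> S \<Longrightarrow> A i ** P = P ** V i" and "w \<in> group_words S"
  shows "hecke_word r A w ** P = P ** hecke_word r V w"
  using assms(2)
proof (induction w)
  case Nil
  show ?case by simp
next
  case (Cons l w)
  have l: "hecke_letter r A l ** P = P ** hecke_letter r V l"
  proof -
    have "mat r ** A (fst l) ** P = P ** (mat r ** V (fst l))"
      using Cons.prems assms(1)[of "fst l"]
      by (simp add: matrix_mul_assoc[symmetric]) (simp add: matrix_mul_assoc mat_central)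
    moreover have "mat (1 - r) ** P = P ** mat (1 - r)"
      by (simp add: mat_central)
    ultimately show ?thesis
      using Cons.prems assms(1)[of "fst l"]
      by (simp add: hecke_letter_def matrix_add_ldistrib matrix_add_mult)
  qed
  have "hecke_word r A (l # w) ** P = hecke_letter r A l ** (P ** hecke_word r V w)"
    using Cons by (simp add: matrix_mul_assoc[symmetric])
  also have "\<dots> = P ** hecke_word r V (l # w)"
    by (simp add: matrix_mul_assoc l)
  finally show ?case .
qed

locale comm_ring_hom =
  fixes \<phi> :: "'a::comm_ring_1 \<Rightarrow> 'b::comm_ring_1"
  assumes add: "\<phi> (x + y) = \<phi> x + \<phi> y" and mult: "\<phi> (x * y) = \<phi> x * \<phi> y" and one: "\<phi> 1 = 1"
begin

lemma zero: "\<phi> 0 = 0"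
  using add[of 0 0] by simp

lemma minus: "\<phi> (- x) = - \<phi> x"
  using add[of x "- x"] zero by (simp add: eq_neg_iff_add_eq_0 add.commute)

lemma diff: "\<phi> (x - y) = \<phi> x - \<phi> y"
  using add[of x "- y"] minus by simp

lemma sum: "\<phi> (sum f A) = (\<Sum>i\<in>A. \<phi> (f i))"
  by (induction A rule: infinite_finite_induct) (simp_all add: zero add)

lemma map_matrix_mult: "map_matrix \<phi> (A ** B) = map_matrix \<phi> A ** map_matrix \<phi> B"
  by (simp add: vec_eq_iff matrix_matrix_mult_def sum mult)

lemma map_matrix_mat: "map_matrix \<phi> (mat c) = mat (\<phi> c)"
  by (simp add: vec_eq_iff mat_def zero)

lemma map_matrix_hecke_word:
  "map_matrix \<phi> (hecke_word r M w) = hecke_word (\<phi> r) (\<lambda>i. map_matrix \<phi> (M i)) w"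
proof (induction w)
  case Nil
  show ?case by (simp add: map_matrix_mat one)
next
  case (Cons l w)
  have "map_matrix \<phi> (hecke_letter r M l) = hecke_letter (\<phi> r) (\<lambda>i. map_matrix \<phi> (M i)) l"
    by (simp add: hecke_letter_def vec_eq_iff mat_mult_nth add mult)
      (simp add: mat_def diff one zero)
  then show ?case using Cons by (simp add: map_matrix_mult)
qed

end

section \<open>The representations attached to the Young diagrams with four boxes\<close>

definition V4 :: "'a::comm_ring_1 \<Rightarrow> nat \<Rightarrow> 'a ^ 1 ^ 1" where
  "V4 q i = mat 1"

definition V31 :: "'a::comm_ring_1 \<Rightarrow> nat \<Rightarrow> 'a ^ 3 ^ 3" where
  "V31 q i =
     (if i = 1 then vector [vector [- q, q, 0], vector [0, 1, 0], vector [0, 0, 1]]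
     else if i = 2 then vector [vector [1, 0, 0], vector [1, - q, q], vector [0, 0, 1]]
     else vector [vector [1, 0, 0], vector [0, 1, 0], vector [0, 1, - q]])"

definition V22 :: "'a::comm_ring_1 \<Rightarrow> nat \<Rightarrow> 'a ^ 2 ^ 2" where
  "V22 q i = (if i = 2 then vector [vector [1, 0], vector [1, - q]]
     else vector [vector [- q, q], vector [0, 1]])"

text \<open>This is \<open>-q\<close> times the inverse transpose of the Burau matrix, rewritten with the quadratic
  relation.\<close>
definition V211 :: "'a::comm_ring_1 \<Rightarrow> nat \<Rightarrow> 'a ^ 3 ^ 3" where
  "V211 q i = mat (1 - q) - Finite_Cartesian_Product.transpose (V31 q i)"

definition V1111 :: "'a::comm_ring_1 \<Rightarrow> nat \<Rightarrow> 'a ^ 1 ^ 1" where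
  "V1111 q i = mat (- q)"

lemma burau_matrix_V31: "burau_matrix = V31 laurent_q"
  by (rule ext) (simp add: burau_matrix_def V31_def Let_def)

lemmas matrix_entry_simps = vec_eq_iff matrix_matrix_mult_def mat_def
  forall_1 forall_2 forall_3 sum_1 sum_2 sum_3

lemma (in comm_ring_hom) map_V:
  "map_matrix \<phi> (V4 x i) = V4 (\<phi> x) i" "map_matrix \<phi> (V31 x i) = V31 (\<phi> x) i"
  "map_matrix \<phi> (V22 x i) = V22 (\<phi> x) i" "map_matrix \<phi> (V211 x i) = V211 (\<phi> x) i"
  "map_matrix \<phi> (V1111 x i) = V1111 (\<phi> x) i"
  by (simp_all add: V4_def V31_def V22_def V211_def V1111_def Finite_Cartesian_Product.transpose_def
      vec_eq_iff forall_2 forall_3 zero one minus diff mat_def)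

lemma hecke_word_V4: "hecke_word r (V4 q) w = mat 1"
proof (induction w)
  case (Cons l w)
  have "hecke_letter r (V4 q) l = mat 1"
    by (simp add: hecke_letter_def V4_def vec_eq_iff mat_mult_nth) (simp add: mat_def)
  then show ?case using Cons by simp
qed simp

context
  fixes q r :: "'a::comm_ring_1"
  assumes qr: "q * r = 1"
begin

private lemma rq: "q * r = 1" "r * q = 1" "r * (q * x) = x" "q * (r * x) = x"
  using qr by (simp_all add: mult.commute mult.assoc[symmetric])

private lemma det_letter:
  "det (hecke_letter r (V31 q) l) = (if snd l then - q else - r)"
  "det (hecke_letter r (V22 q) l) = (if snd l then - q else - r)"
  by (simp_all add: hecke_letter_def det_2 det_3 mat_mult_nth V31_def V22_def)
    (simp_all add: mat_def algebra_simps rq)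

lemma det_V22_word: "det (hecke_word r (V22 q) w) = det (hecke_word r (V31 q) w)"
  by (induction w) (simp_all add: det_mul det_letter)

lemma V1111_word: "hecke_word r (V1111 q) w = mat (det (hecke_word r (V31 q) w))"
proof (induction w)
  case (Cons l w)
  have "hecke_letter r (V1111 q) l = mat (if snd l then - q else - r)"
    by (simp add: hecke_letter_def V1111_def vec_eq_iff mat_mult_nth) (simp add: mat_def rq)
  then show ?case using Cons by (simp add: det_mul det_letter mat_mult_mat)
qed simp

text \<open>Both factors are multiplicative in the word, the transposed one in reverse order, so the inner
  product of letters is a scalar that can be moved out.\<close>
lemma V211_word:
  "hecke_word r (V211 q) w ** Finite_Cartesian_Product.transpose (hecke_word r (V31 q) w)
    = mat (det (hecke_word r (V31 q) w))"
proof (induction w)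
  case Nil
  show ?case by (simp add: transpose_mat)
next
  case (Cons l w)
  let ?X = "hecke_letter r (V211 q) l"
  let ?Y = "Finite_Cartesian_Product.transpose (hecke_letter r (V31 q) l)"
  have "?X ** ?Y = mat (if snd l then - q else - r)"
    by (simp add: hecke_letter_def V211_def V31_def matrix_entry_simps
        Finite_Cartesian_Product.transpose_def algebra_simps rq)
  then have l: "?X ** ?Y = mat (det (hecke_letter r (V31 q) l))"
    by (simp add: det_letter)
  show ?case
    by (simp add: matrix_transpose_mul matrix_mult_middle Cons.IH det_mul)
     (simp add: matrix_mul_assoc mat_central[of ?X] l mat_mult_mat matrix_mul_assoc[symmetric] mult.commute)
qed

end

section \<open>Evaluation of Laurent polynomials\<close>

lemma poly_mapping_add_induct [case_names zero add]:
  assumes "P 0" and "\<And>f k c. P f \<Longrightarrow> P (f + Poly_Mapping.single k c)"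
  shows "P (p :: 'a \<Rightarrow>\<^sub>0 'b::comm_monoid_add)"
proof (induction p rule: update_induct)
  case const
  show ?case by (rule assms(1))
next
  case (update f a b)
  have "Poly_Mapping.update a b f = f + Poly_Mapping.single a b"
    by (rule poly_mapping_eqI)
      (use update in \<open>auto simp: lookup_update lookup_add lookup_single when_def in_keys_iff\<close>)
  then show ?case using assms(2) update by simp
qed

text \<open>Laurent polynomials and the free algebra are both monoid algebras. Evaluation homomorphisms out
  of either are extended from their values \<open>F k c\<close> on monomials.\<close>
definition additive_extension :: "('k \<Rightarrow> 'c \<Rightarrow> 'm) \<Rightarrow> ('k \<Rightarrow>\<^sub>0 'c::comm_monoid_add) \<Rightarrow> 'm::comm_monoid_add" where
  "additive_extension F p = (\<Sum>k\<in>Poly_Mapping.keys p. F k (Poly_Mapping.lookup p k))"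

locale additive_coeffs =
  fixes F :: "'k \<Rightarrow> 'c::comm_monoid_add \<Rightarrow> 'm::comm_monoid_add"
  assumes F_0: "F k 0 = 0" and F_add: "F k (c + d) = F k c + F k d"
begin

lemma extension_superset:
  assumes "finite K" "Poly_Mapping.keys p \<subseteq> K"
  shows "additive_extension F p = (\<Sum>k\<in>K. F k (Poly_Mapping.lookup p k))"
  unfolding additive_extension_def
  by (rule sum.mono_neutral_left) (use assms in \<open>auto simp: in_keys_iff F_0\<close>)

lemma extension_add: "additive_extension F (p + p') = additive_extension F p + additive_extension F p'"
proof -
  let ?K = "Poly_Mapping.keys p \<union> Poly_Mapping.keys p'"
  have "Poly_Mapping.keys (p + p') \<subseteq> ?K" by (rule Poly_Mapping.keys_add)
  then show ?thesis
    by (simp add: extension_superset[of ?K] lookup_add F_add sum.distrib)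
qed

lemma extension_single: "additive_extension F (Poly_Mapping.single k c) = F k c"
  by (simp add: extension_superset[of "{k}"])

lemma extension_zero: "additive_extension F 0 = 0"
  by (simp add: additive_extension_def)

end

lemma additive_extension_mult:
  fixes F :: "'k::monoid_add \<Rightarrow> 'c::semiring_0 \<Rightarrow> 'm::ab_group_add" and M :: "'m \<Rightarrow> 'm \<Rightarrow> 'm"
  assumes "additive_coeffs F"
    and left: "\<And>x y z. M (x + y) z = M x z + M y z"
    and right: "\<And>x y z. M x (y + z) = M x y + M x z"
    and mult: "\<And>k l c d. F (k + l) (c * d) = M (F k c) (F l d)"
  shows "additive_extension F (p * p') = M (additive_extension F p) (additive_extension F p')"
proof -
  interpret additive_coeffs F by fact
  have z: "M 0 x = 0" "M x 0 = 0" for x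
    using left[of 0 0 x] right[of x 0 0] by simp_all
  show ?thesis
  proof (induction p rule: poly_mapping_add_induct)
    case zero
    show ?case by (simp add: extension_zero z)
  next
    case (add p k c)
    have "additive_extension F (Poly_Mapping.single k c * p') = M (F k c) (additive_extension F p')"
      by (induction p' rule: poly_mapping_add_induct)
        (simp_all add: extension_zero z distrib_left extension_add mult_single extension_single mult right)
    then show ?case using add by (simp add: distrib_right extension_add extension_single left)
  qed
qed

definition laurent_eval :: "'k::field \<Rightarrow> laurent \<Rightarrow> 'k" where
  "laurent_eval a = additive_extension (\<lambda>k c. of_int c * a powi k)"

lemma laurent_eval_single: "laurent_eval a (Poly_Mapping.single k c) = of_int c * a powi k"
  unfolding laurent_eval_def
  by (rule additive_coeffs.extension_single) (simp add: additive_coeffs_def algebra_simps)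

lemma comm_ring_hom_laurent_eval:
  assumes "a \<noteq> 0"
  shows "comm_ring_hom (laurent_eval a)"
proof
  let ?F = "\<lambda>k c. of_int c * a powi k"
  have F: "additive_coeffs ?F" by (simp add: additive_coeffs_def algebra_simps)
  show "laurent_eval a (x + y) = laurent_eval a x + laurent_eval a y" for x y
    unfolding laurent_eval_def by (rule additive_coeffs.extension_add[OF F])
  show "laurent_eval a (x * y) = laurent_eval a x * laurent_eval a y" for x y
    unfolding laurent_eval_def
    by (rule additive_extension_mult[OF F])
      (use assms in \<open>simp_all add: algebra_simps power_int_add\<close>)
  show "laurent_eval a 1 = 1"
    unfolding single_one[symmetric] laurent_eval_single by simp
qed

lemma to_fract_sum: "to_fract (sum f A) = (\<Sum>i\<in>A. to_fract (f i))"
  by (induction A rule: infinite_finite_induct) simp_all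

lemma ratfun_q_to_fract: "ratfun_q = to_fract [:0, 1:]"
  by (simp add: ratfun_q_def to_fract_def)

lemma to_fract_monom: "to_fract (monom (of_int c :: rat) n) = of_int c * ratfun_q ^ n"
proof -
  have "to_fract (of_int m) = (of_int m :: ratfun)" for m
    by (induction m rule: int_induct[where k = 0]) simp_all
  moreover have "monom (of_int c :: rat) n = of_int c * [:0, 1:] ^ n"
    by (simp add: monom_altdef of_int_poly)
  moreover have "to_fract (p ^ n) = to_fract p ^ n" for p :: "rat poly"
    by (induction n) simp_all
  ultimately show ?thesis by (simp add: ratfun_q_to_fract)
qed

lemma inj_laurent_eval: "inj (laurent_eval ratfun_q)"
proof (rule injI)
  interpret comm_ring_hom "laurent_eval ratfun_q"
    by (rule comm_ring_hom_laurent_eval) (rule ratfun_q_nonzero)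
  fix x y assume "laurent_eval ratfun_q x = laurent_eval ratfun_q y"
  define p where "p = x - y"
  then have p: "laurent_eval ratfun_q p = 0" using \<open>laurent_eval ratfun_q x = laurent_eval ratfun_q y\<close>
    by (simp add: diff)
  let ?K = "Poly_Mapping.keys p"
  \<comment> \<open>Multiplication by \<open>q\<^sup>N\<close> clears the negative exponents and reduces to ordinary polynomials.\<close>
  obtain N :: nat where N: "\<And>k. k \<in> ?K \<Longrightarrow> - int N \<le> k"
  proof
    show "- int (nat (- Min (insert 0 ?K))) \<le> k" if "k \<in> ?K" for k
    proof -
      have "Min (insert 0 ?K) \<le> k" using that by (intro Min_le) auto
      then show ?thesis by linarith
    qed
  qed
  have "to_fract (\<Sum>k\<in>?K. monom (of_int (Poly_Mapping.lookup p k)) (nat (k + int N)))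
      = (\<Sum>k\<in>?K. of_int (Poly_Mapping.lookup p k) * ratfun_q powi k * ratfun_q ^ N)"
  proof (simp only: to_fract_sum to_fract_monom, rule sum.cong)
    fix k assume "k \<in> ?K"
    then have "ratfun_q ^ nat (k + int N) = ratfun_q powi (k + int N)"
      using N[of k] by (simp add: power_int_def)
    then show "of_int (Poly_Mapping.lookup p k) * ratfun_q ^ nat (k + int N)
        = of_int (Poly_Mapping.lookup p k) * ratfun_q powi k * ratfun_q ^ N"
      by (simp add: power_int_add ratfun_q_nonzero)
  qed simp
  also have "\<dots> = laurent_eval ratfun_q p * ratfun_q ^ N"
    by (simp add: laurent_eval_def additive_extension_def sum_distrib_right)
  finally have 0: "(\<Sum>k\<in>?K. monom (of_int (Poly_Mapping.lookup p k) :: rat) (nat (k + int N))) = 0"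
    by (simp only: p mult_zero_left to_fract_eq_0_iff)
  have "?K = {}"
  proof (rule ccontr)
    assume "?K \<noteq> {}"
    then obtain l where l: "l \<in> ?K" by blast
    have "0 = (\<Sum>k\<in>?K. coeff (monom (of_int (Poly_Mapping.lookup p k) :: rat) (nat (k + int N))) (nat (l + int N)))"
      using arg_cong[OF 0, of "\<lambda>p. coeff p (nat (l + int N))"] by (simp add: coeff_sum)
    also have "\<dots> = (\<Sum>k\<in>?K. if k = l then of_int (Poly_Mapping.lookup p k) else 0)"
    proof (rule sum.cong)
      fix k assume "k \<in> ?K"
      then have "nat (k + int N) = nat (l + int N) \<longleftrightarrow> k = l"
        using N[of k] N[OF l] by auto
      then show "coeff (monom (of_int (Poly_Mapping.lookup p k) :: rat) (nat (k + int N))) (nat (l + int N))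
          = (if k = l then of_int (Poly_Mapping.lookup p k) else 0)"
        by simp
    qed simp
    also have "\<dots> = of_int (Poly_Mapping.lookup p l)"
      using l by simp
    finally show False using l by (simp add: in_keys_iff)
  qed
  then show "x = y" by (simp add: p_def)
qed

definition qpow :: "int \<Rightarrow> laurent" where
  "qpow k = Poly_Mapping.single k 1"

lemma qpow_mult: "qpow k * qpow l = qpow (k + l)"
  by (simp add: qpow_def mult_single)

lemma qpow_0: "qpow 0 = 1"
  by (simp add: qpow_def)

lemma qpow_eq_1_iff: "qpow k = 1 \<longleftrightarrow> k = 0"
proof
  assume "qpow k = 1"
  then have "Poly_Mapping.lookup (qpow k) k = Poly_Mapping.lookup 1 k" by simp
  then show "k = 0" by (simp add: qpow_def lookup_one when_def split: if_splits)
qed (simp add: qpow_0)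

lemma laurent_q_qpow: "laurent_q = qpow 1"
  by (simp add: qpow_def laurent_q_def)

abbreviation "laurent_q_inv \<equiv> qpow (- 1)"

lemma laurent_q_q_inv: "laurent_q * laurent_q_inv = 1"
  by (simp add: laurent_q_qpow qpow_mult qpow_0)

section \<open>The two-row square representation and the modular group\<close>

text \<open>These are \<open>\<sigma>\<^sub>1\<sigma>\<^sub>2\<sigma>\<^sub>1\<close> and \<open>\<sigma>\<^sub>1\<sigma>\<^sub>2\<close>, which generate the three-strand braid group and map
  to generators of orders 2 and 3 of its quotient by the centre.\<close>
definition V22_x :: "'a::comm_ring_1 \<Rightarrow> 'a ^ 2 ^ 2" where
  "V22_x q = V22 q 1 ** V22 q 2 ** V22 q 1"

definition V22_y :: "'a::comm_ring_1 \<Rightarrow> 'a ^ 2 ^ 2" where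
  "V22_y q = V22 q 1 ** V22 q 2"

lemma V22_x_square: "V22_x q ** V22_x q = mat (q ^ 3)"
  by (simp add: V22_x_def V22_def matrix_entry_simps algebra_simps power3_eq_cube)

lemma V22_y_cube: "V22_y q ** V22_y q ** V22_y q = mat (q ^ 3)"
  by (simp add: V22_y_def V22_def matrix_entry_simps algebra_simps power3_eq_cube)

text \<open>The two building blocks are the products that become, up to sign, the elementary unipotent
  matrices with nonnegative entries at \<open>q = -1\<close>.\<close>
inductive positive_word :: "'a::comm_ring_1 \<Rightarrow> 'a ^ 2 ^ 2 \<Rightarrow> bool" for q where
  empty: "positive_word q (mat 1)"
| xy: "positive_word q P \<Longrightarrow> positive_word q (V22_x q ** V22_y q ** P)"
| xyy: "positive_word q P \<Longrightarrow> positive_word q (V22_x q ** (V22_y q ** V22_y q) ** P)"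

definition normal_forms :: "(laurent ^ 2 ^ 2) set" where
  "normal_forms = {mat (qpow (3 * k)) ** (Y ** (P ** X)) | k Y P X.
     positive_word laurent_q P \<and> Y \<in> {mat 1, V22_y laurent_q, V22_y laurent_q ** V22_y laurent_q} \<and>
     X \<in> {mat 1, V22_x laurent_q}}"

lemma normal_forms_scalar:
  assumes "A \<in> normal_forms"
  shows "mat (qpow (3 * k)) ** A \<in> normal_forms"
proof -
  from assms obtain l Y P X where *: "A = mat (qpow (3 * l)) ** (Y ** (P ** X))"
    "positive_word laurent_q P" "Y \<in> {mat 1, V22_y laurent_q, V22_y laurent_q ** V22_y laurent_q}"
    "X \<in> {mat 1, V22_x laurent_q}"
    unfolding normal_forms_def by blast
  have "mat (qpow (3 * k)) ** A = mat (qpow (3 * (k + l))) ** (Y ** (P ** X))"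
    by (simp add: * matrix_mul_assoc mat_mult_mat qpow_mult algebra_simps)
  then show ?thesis using * unfolding normal_forms_def by blast
qed

lemma normal_formsI:
  assumes "positive_word laurent_q P" "Y \<in> {mat 1, V22_y laurent_q, V22_y laurent_q ** V22_y laurent_q}"
    "X \<in> {mat 1, V22_x laurent_q}"
  shows "Y ** (P ** X) \<in> normal_forms" "mat (laurent_q ^ 3) ** (Y ** (P ** X)) \<in> normal_forms"
proof -
  have "Y ** (P ** X) = mat (qpow (3 * 0)) ** (Y ** (P ** X))"
    by (simp add: qpow_0)
  then show 1: "Y ** (P ** X) \<in> normal_forms" using assms unfolding normal_forms_def by blast
  have "laurent_q ^ 3 = qpow (3 * 1)"
    by (simp add: laurent_q_qpow power3_eq_cube qpow_mult)
  then show "mat (laurent_q ^ 3) ** (Y ** (P ** X)) \<in> normal_forms"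
    using normal_forms_scalar[OF 1, of 1] by simp
qed

lemma normal_forms_V22_y:
  assumes "A \<in> normal_forms"
  shows "V22_y laurent_q ** A \<in> normal_forms"
proof -
  let ?y = "V22_y laurent_q" and ?x = "V22_x laurent_q"
  from assms obtain k Y P X where *: "A = mat (qpow (3 * k)) ** (Y ** (P ** X))"
    "positive_word laurent_q P" "Y \<in> {mat 1, ?y, ?y ** ?y}" "X \<in> {mat 1, ?x}"
    unfolding normal_forms_def by blast
  have "?y ** (Y ** (P ** X)) \<in> normal_forms"
  proof (cases "Y = ?y ** ?y")
    case True
    have eq: "?y ** (Y ** (P ** X)) = mat (laurent_q ^ 3) ** (mat 1 ** (P ** X))"
      unfolding True V22_y_cube[of laurent_q, symmetric] by (simp only: matrix_mul_assoc matrix_mul_lid matrix_mul_rid)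
    show ?thesis unfolding eq by (rule normal_formsI(2)[OF *(2) _ *(4)]) simp
  next
    case False
    have eq: "?y ** (Y ** (P ** X)) = (?y ** Y) ** (P ** X)"
      by (simp only: matrix_mul_assoc)
    have "?y ** Y \<in> {mat 1, ?y, ?y ** ?y}" using False *(3) by auto
    then show ?thesis unfolding eq by (rule normal_formsI(1)[OF *(2) _ *(4)])
  qed
  moreover have "?y ** A = mat (qpow (3 * k)) ** (?y ** (Y ** (P ** X)))"
    by (simp only: * matrix_mul_assoc mat_central)
  ultimately show ?thesis by (simp only: normal_forms_scalar)
qed

lemma normal_forms_V22_x:
  assumes "A \<in> normal_forms"
  shows "V22_x laurent_q ** A \<in> normal_forms"
proof -
  let ?y = "V22_y laurent_q" and ?x = "V22_x laurent_q"
  have xx: "?x ** (?x ** B) = mat (laurent_q ^ 3) ** B" for B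
    using V22_x_square[of laurent_q] by (simp add: matrix_mul_assoc)
  from assms obtain k Y P X where *: "A = mat (qpow (3 * k)) ** (Y ** (P ** X))"
    "positive_word laurent_q P" "Y \<in> {mat 1, ?y, ?y ** ?y}" "X \<in> {mat 1, ?x}"
    unfolding normal_forms_def by blast
  have "?x ** (Y ** (P ** X)) \<in> normal_forms"
  proof (cases "Y = mat 1")
    case True
    from *(2) show ?thesis
    proof cases
      case empty
      show ?thesis
      proof (cases "X = mat 1")
        case X: True
        have eq: "?x ** (Y ** (P ** X)) = mat 1 ** (mat 1 ** ?x)"
          by (simp add: True X empty)
        show ?thesis unfolding eq by (intro normal_formsI(1) positive_word.empty) simp_all
      next
        case False
        then have eq: "?x ** (Y ** (P ** X)) = mat (laurent_q ^ 3) ** (mat 1 ** (mat 1 ** mat 1))"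
          using *(4) V22_x_square[of laurent_q] by (simp add: True empty)
        show ?thesis unfolding eq by (intro normal_formsI(2) positive_word.empty) simp_all
      qed
    next
      case (xy P')
      have eq: "?x ** (Y ** (P ** X)) = mat (laurent_q ^ 3) ** (?y ** (P' ** X))"
        unfolding True xy(1) xx[symmetric] by (simp only: matrix_mul_assoc matrix_mul_lid matrix_mul_rid)
      show ?thesis unfolding eq by (rule normal_formsI(2)[OF xy(2) _ *(4)]) simp
    next
      case (xyy P')
      have eq: "?x ** (Y ** (P ** X)) = mat (laurent_q ^ 3) ** ((?y ** ?y) ** (P' ** X))"
        unfolding True xyy(1) xx[symmetric] by (simp only: matrix_mul_assoc matrix_mul_lid matrix_mul_rid)
      show ?thesis unfolding eq by (rule normal_formsI(2)[OF xyy(2) _ *(4)]) simp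
    qed
  next
    case False
    then have P: "positive_word laurent_q (?x ** Y ** P)"
      using * positive_word.intros by blast
    have eq: "?x ** (Y ** (P ** X)) = mat 1 ** ((?x ** Y ** P) ** X)"
      by (simp only: matrix_mul_assoc matrix_mul_lid)
    show ?thesis unfolding eq by (rule normal_formsI(1)[OF P _ *(4)]) simp
  qed
  moreover have "?x ** A = mat (qpow (3 * k)) ** (?x ** (Y ** (P ** X)))"
    by (simp only: * matrix_mul_assoc mat_central)
  ultimately show ?thesis by (simp only: normal_forms_scalar)
qed

text \<open>With \<open>z = x\<^sup>2 = y\<^sup>3\<close> central, \<open>\<sigma>\<^sub>1 = y\<^sup>-\<^sup>1 x = z\<^sup>-\<^sup>1 y\<^sup>2 x\<close> and \<open>\<sigma>\<^sub>2 = x\<^sup>-\<^sup>1 y\<^sup>2 = z\<^sup>-\<^sup>1 x y\<^sup>2\<close>, and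
  their inverses are \<open>z\<^sup>-\<^sup>1 x y\<close> and \<open>z\<^sup>-\<^sup>1 y x\<close>. The third generator acts like the first.\<close>
lemma V22_letter_normal:
  "\<exists>k u. hecke_letter laurent_q_inv (V22 laurent_q) l = mat (qpow (3 * k)) ** u \<and>
     (u = V22_y laurent_q ** (V22_y laurent_q ** V22_x laurent_q) \<or>
      u = V22_x laurent_q ** (V22_y laurent_q ** V22_y laurent_q) \<or>
      u = V22_x laurent_q ** V22_y laurent_q \<or> u = V22_y laurent_q ** V22_x laurent_q)"
proof -
  obtain i e where l: "l = (i, e)" by (cases l)
  note s = hecke_letter_def V22_y_def V22_x_def V22_def matrix_entry_simps laurent_q_qpow
    algebra_simps qpow_mult qpow_0 l
  define u where "u =
    (if i = 2 then if e then V22_x laurent_q ** (V22_y laurent_q ** V22_y laurent_q) else V22_y laurent_q ** V22_x laurent_q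
     else if e then V22_y laurent_q ** (V22_y laurent_q ** V22_x laurent_q) else V22_x laurent_q ** V22_y laurent_q)"
  have "hecke_letter laurent_q_inv (V22 laurent_q) l = mat (qpow (3 * - 1)) ** u"
    unfolding u_def by (simp add: s)
  moreover have "u = V22_y laurent_q ** (V22_y laurent_q ** V22_x laurent_q) \<or>
      u = V22_x laurent_q ** (V22_y laurent_q ** V22_y laurent_q) \<or>
      u = V22_x laurent_q ** V22_y laurent_q \<or> u = V22_y laurent_q ** V22_x laurent_q"
    by (simp add: u_def)
  ultimately show ?thesis by (intro exI conjI)
qed

lemma V22_word_normal: "hecke_word laurent_q_inv (V22 laurent_q) w \<in> normal_forms"
proof (induction w)
  case Nil
  show ?case using normal_formsI[OF positive_word.empty, of "mat 1" "mat 1"] by simp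
next
  case (Cons l w)
  obtain k u where "hecke_letter laurent_q_inv (V22 laurent_q) l = mat (qpow (3 * k)) ** u"
    "u = V22_y laurent_q ** (V22_y laurent_q ** V22_x laurent_q) \<or>
      u = V22_x laurent_q ** (V22_y laurent_q ** V22_y laurent_q) \<or>
      u = V22_x laurent_q ** V22_y laurent_q \<or> u = V22_y laurent_q ** V22_x laurent_q"
    using V22_letter_normal by blast
  then show ?case
    using Cons normal_forms_scalar normal_forms_V22_y normal_forms_V22_x
    by (auto simp: matrix_mul_assoc[symmetric])
qed

lemma V22_xy_minus_one:
  "V22_x (- 1) = vector [vector [0, - 1], vector [1, 0]]"
  "V22_y (- 1) = vector [vector [0, - 1], vector [1, 1]]"
  "V22_y (- 1) ** V22_y (- 1) = vector [vector [- 1, - 1], vector [1, 0]]"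
  by (simp_all add: V22_x_def V22_y_def V22_def matrix_entry_simps)

locale hom_to_minus_one = comm_ring_hom \<phi> for \<phi> :: "laurent \<Rightarrow> 'b::linordered_idom" +
  assumes phi_q: "\<phi> laurent_q = - 1"
begin

lemma map_V22_xy: "map_matrix \<phi> (V22_x laurent_q) = V22_x (- 1)" "map_matrix \<phi> (V22_y laurent_q) = V22_y (- 1)"
  by (simp_all add: V22_x_def V22_y_def map_matrix_mult map_V phi_q)

text \<open>Multiplying by an elementary unipotent matrix keeps the entries nonnegative and the diagonal
  positive, and it makes the off-diagonal sum positive for good.\<close>
lemma positive_word_positive:
  assumes "positive_word laurent_q P"
  shows "\<exists>e A. map_matrix \<phi> P = mat e ** A \<and> e \<noteq> 0 \<and> 1 \<le> A $ 1 $ 1 \<and> 1 \<le> A $ 2 $ 2 \<and>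
    0 \<le> A $ 1 $ 2 \<and> 0 \<le> A $ 2 $ 1 \<and> (P = mat 1 \<or> 1 \<le> A $ 1 $ 2 + A $ 2 $ 1)"
  using assms
proof (induction rule: positive_word.induct)
  case empty
  show ?case by (intro exI[of _ 1] exI[of _ "mat 1"]) (simp add: map_matrix_mat one, simp add: mat_def)
next
  case (xy P)
  then obtain e A where *: "map_matrix \<phi> P = mat e ** A" "e \<noteq> 0" "1 \<le> A $ 1 $ 1" "1 \<le> A $ 2 $ 2"
    "0 \<le> A $ 1 $ 2" "0 \<le> A $ 2 $ 1" by blast
  define U :: "'b ^ 2 ^ 2" where "U = vector [vector [1, 1], vector [0, 1]]"
  have "V22_x (- 1) ** V22_y (- 1) = mat (- 1) ** U"
    by (simp add: V22_xy_minus_one U_def matrix_entry_simps)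
  then have "map_matrix \<phi> (V22_x laurent_q ** V22_y laurent_q ** P) = mat (- 1) ** U ** (mat e ** A)"
    by (simp add: map_matrix_mult map_V22_xy *(1))
  also have "\<dots> = mat (- e) ** (U ** A)"
    by (simp add: vec_eq_iff forall_2 U_def matrix_matrix_mult_def sum_2 mat_def algebra_simps)
  finally have eq: "map_matrix \<phi> (V22_x laurent_q ** V22_y laurent_q ** P) = mat (- e) ** (U ** A)" .
  show ?case
    by (intro exI[of _ "- e"] exI[of _ "U ** A"] conjI eq)
      (use * in \<open>simp_all add: U_def matrix_matrix_mult_def sum_2\<close>)
next
  case (xyy P)
  then obtain e A where *: "map_matrix \<phi> P = mat e ** A" "e \<noteq> 0" "1 \<le> A $ 1 $ 1" "1 \<le> A $ 2 $ 2"
    "0 \<le> A $ 1 $ 2" "0 \<le> A $ 2 $ 1" by blast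
  define U :: "'b ^ 2 ^ 2" where "U = vector [vector [1, 0], vector [1, 1]]"
  have "V22_x (- 1) ** (V22_y (- 1) ** V22_y (- 1)) = mat (- 1) ** U"
    by (simp add: V22_xy_minus_one U_def matrix_entry_simps)
  then have "map_matrix \<phi> (V22_x laurent_q ** (V22_y laurent_q ** V22_y laurent_q) ** P)
      = mat (- 1) ** U ** (mat e ** A)"
    by (simp add: map_matrix_mult map_V22_xy *(1))
  also have "\<dots> = mat (- e) ** (U ** A)"
    by (simp add: vec_eq_iff forall_2 U_def matrix_matrix_mult_def sum_2 mat_def algebra_simps)
  finally have eq: "map_matrix \<phi> (V22_x laurent_q ** (V22_y laurent_q ** V22_y laurent_q) ** P)
      = mat (- e) ** (U ** A)" .
  show ?case
    by (intro exI[of _ "- e"] exI[of _ "U ** A"] conjI eq)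
      (use * in \<open>simp_all add: U_def matrix_matrix_mult_def sum_2\<close>)
qed

text \<open>A scalar matrix has vanishing off-diagonal entries. Multiplying a nonnegative matrix with
  positive diagonal by \<open>x\<close> on the right, by \<open>y\<close> or \<open>y\<^sup>2\<close> on the left, or both, leaves a nonzero
  off-diagonal entry, and so does a nonempty positive word by itself.\<close>
lemma normal_form_scalar:
  assumes "M \<in> normal_forms" "map_matrix \<phi> M = mat 1"
  shows "\<exists>k. M = mat (qpow (3 * k))"
proof -
  let ?x = "V22_x (- 1) :: 'b ^ 2 ^ 2" and ?y = "V22_y (- 1) :: 'b ^ 2 ^ 2"
  from assms(1) obtain k Y P X where M: "M = mat (qpow (3 * k)) ** (Y ** (P ** X))"
    and P: "positive_word laurent_q P"
    and Y: "Y \<in> {mat 1, V22_y laurent_q, V22_y laurent_q ** V22_y laurent_q}"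
    and X: "X \<in> {mat 1, V22_x laurent_q}"
    unfolding normal_forms_def by blast
  obtain e A where A: "map_matrix \<phi> P = mat e ** A" "e \<noteq> 0" "1 \<le> A $ 1 $ 1" "1 \<le> A $ 2 $ 2"
    "0 \<le> A $ 1 $ 2" "0 \<le> A $ 2 $ 1" "P = mat 1 \<or> 1 \<le> A $ 1 $ 2 + A $ 2 $ 1"
    using positive_word_positive[OF P] by blast
  define c where "c = \<phi> (qpow (3 * k)) * e"
  have "\<phi> (qpow (3 * k)) * \<phi> (qpow (- 3 * k)) = 1"
    by (simp add: mult[symmetric] qpow_mult qpow_0 one)
  then have c: "c \<noteq> 0" using A(2) by (auto simp: c_def)
  let ?Y = "map_matrix \<phi> Y" and ?X = "map_matrix \<phi> X"
  have "mat 1 = mat (\<phi> (qpow (3 * k))) ** (?Y ** (mat e ** A ** ?X))"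
    using assms(2) by (simp add: M A(1) map_matrix_mult map_matrix_mat)
  also have "\<dots> = mat c ** (?Y ** (A ** ?X))"
  proof -
    have "?Y ** (mat e ** A ** ?X) = mat e ** (?Y ** (A ** ?X))"
      by (metis mat_central matrix_mul_assoc)
    then show ?thesis by (simp only: matrix_mul_assoc c_def mat_mult_mat[symmetric])
  qed
  finally have eq: "mat c ** (?Y ** (A ** ?X)) = mat 1" by simp
  have off: "(?Y ** (A ** ?X)) $ i $ j = 0" if "i \<noteq> j" for i j
  proof -
    have "(mat c ** (?Y ** (A ** ?X))) $ i $ j = 0" unfolding eq using that by (simp add: mat_def)
    then show ?thesis using c by (simp add: mat_mult_nth)
  qed
  have off: "(?Y ** (A ** ?X)) $ 1 $ 2 = 0" "(?Y ** (A ** ?X)) $ 2 $ 1 = 0"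
    by (simp_all add: off)
  have Y': "?Y \<in> {mat 1, ?y, ?y ** ?y}" and X': "?X \<in> {mat 1, ?x}"
    using X Y by (auto simp: map_matrix_mult map_V22_xy map_matrix_mat one)
  have "X = mat 1"
  proof (rule ccontr)
    assume "X \<noteq> mat 1"
    then have "?X = ?x" using X by (auto simp: map_V22_xy)
    then show False
      using off A(3-6) Y' by (auto simp: V22_xy_minus_one matrix_matrix_mult_def sum_2 mat_def
          simp del: nth_map_matrix)
  qed
  moreover have "Y = mat 1"
  proof (rule ccontr)
    assume "Y \<noteq> mat 1"
    then have "?Y \<in> {?y, ?y ** ?y}" using Y by (auto simp: map_V22_xy map_matrix_mult)
    then show False
      using off A(3-6) X' by (auto simp: V22_xy_minus_one matrix_matrix_mult_def sum_2 mat_def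
          simp del: nth_map_matrix)
  qed
  moreover have "P = mat 1"
    using off A(7) \<open>X = mat 1\<close> \<open>Y = mat 1\<close> by (auto simp: map_matrix_mat one)
  ultimately show ?thesis unfolding M by (metis matrix_mul_rid)
qed

end

section \<open>The kernel of the Burau representation\<close>

context
  fixes w
  assumes w: "w \<in> group_words {1..<4}"
    and triv: "hecke_word laurent_q_inv (V31 laurent_q) w = mat 1"
begin

lemma V1111_trivial: "hecke_word laurent_q_inv (V1111 laurent_q) w = mat 1"
  using V1111_word[OF laurent_q_q_inv, of w] triv by simp

lemma V211_trivial: "hecke_word laurent_q_inv (V211 laurent_q) w = mat 1"
  using V211_word[OF laurent_q_q_inv, of w] triv by simp

text \<open>At \<open>q = -1\<close> the vector \<open>(1, 0, 1)\<close> is fixed by the Burau matrices, and the action on the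
  quotient by it is \<open>V\<^sub>2\<^sub>2\<close>. This gives \<open>V\<^sub>2\<^sub>2(w) = q\<^sup>3\<^sup>k\<close>, and the determinant forces \<open>k = 0\<close>.\<close>
lemma V22_trivial: "hecke_word laurent_q_inv (V22 laurent_q) w = mat 1"
proof -
  interpret hom_to_minus_one "laurent_eval (- 1 :: rat)"
  proof -
    interpret comm_ring_hom "laurent_eval (- 1 :: rat)" by (rule comm_ring_hom_laurent_eval) simp
    show "hom_to_minus_one (laurent_eval (- 1 :: rat))"
      by unfold_locales (simp add: laurent_q_def laurent_eval_single)
  qed
  let ?W2 = "hecke_word laurent_q_inv (V22 laurent_q) w" and ?W3 = "hecke_word laurent_q_inv (V31 laurent_q) w"
  have r: "laurent_eval (- 1 :: rat) laurent_q_inv = - 1"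
    by (simp add: qpow_def laurent_eval_single)
  \<comment> \<open>The projection along \<open>(1, 0, 1)\<close> in the coordinates \<open>(v\<^sub>1 - v\<^sub>3, v\<^sub>2)\<close>, and a section of it.\<close>
  define \<pi> :: "rat ^ 3 ^ 2" where "\<pi> = vector [vector [1, 0, - 1], vector [0, 1, 0]]"
  define \<iota> :: "rat ^ 2 ^ 3" where "\<iota> = vector [vector [1, 0], vector [0, 1], vector [0, 0]]"
  have \<pi>\<iota>: "\<pi> ** \<iota> = mat 1"
    by (simp add: \<pi>_def \<iota>_def matrix_entry_simps)
  have "V22 (- 1) i ** \<pi> = \<pi> ** V31 (- 1) i" if "i \<in> {1..<4}" for i
  proof -
    from that show ?thesis by (cases rule: less4_cases) (simp_all add: \<pi>_def V22_def V31_def matrix_entry_simps)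
  qed
  then have "hecke_word (- 1) (V22 (- 1)) w ** \<pi> = \<pi> ** hecke_word (- 1) (V31 (- 1)) w"
    using w by (rule hecke_word_intertwine)
  moreover have "hecke_word (- 1) (V31 (- 1)) w = map_matrix (laurent_eval (- 1 :: rat)) ?W3"
    by (simp add: map_matrix_hecke_word map_V r phi_q)
  ultimately have "hecke_word (- 1) (V22 (- 1)) w ** (\<pi> ** \<iota>) = \<pi> ** \<iota>"
    by (simp add: triv map_matrix_mat one matrix_mul_assoc)
  then have "map_matrix (laurent_eval (- 1 :: rat)) ?W2 = mat 1"
    by (simp add: \<pi>\<iota> map_matrix_hecke_word map_V r phi_q)
  then obtain k where k: "?W2 = mat (qpow (3 * k))"
    using normal_form_scalar[OF V22_word_normal] by blast
  have "det ?W2 = 1"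
    by (simp add: det_V22_word[OF laurent_q_q_inv] triv)
  moreover have "det ?W2 = qpow (6 * k)"
    unfolding k by (simp add: det_2 mat_def qpow_mult)
  ultimately have "k = 0" by (simp add: qpow_eq_1_iff)
  then show ?thesis unfolding k by (simp add: qpow_0)
qed

end

lemma ratfun_words_trivial:
  assumes w: "w \<in> group_words {1..<4}"
    and triv: "hecke_word laurent_q_inv (V31 laurent_q) w = mat 1"
  defines "r \<equiv> inverse ratfun_q"
  shows "hecke_word r (V31 ratfun_q) w = mat 1" "hecke_word r (V22 ratfun_q) w = mat 1"
    "hecke_word r (V211 ratfun_q) w = mat 1" "hecke_word r (V1111 ratfun_q) w = mat 1"
proof -
  interpret comm_ring_hom "laurent_eval ratfun_q"
    by (rule comm_ring_hom_laurent_eval) (rule ratfun_q_nonzero)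
  have q: "laurent_eval ratfun_q laurent_q = ratfun_q" "laurent_eval ratfun_q laurent_q_inv = r"
    by (simp_all add: laurent_q_def qpow_def laurent_eval_single r_def)
  note m = map_matrix_hecke_word[where r = laurent_q_inv and w = w, unfolded map_V q, symmetric]
  show "hecke_word r (V31 ratfun_q) w = mat 1" "hecke_word r (V22 ratfun_q) w = mat 1"
    "hecke_word r (V211 ratfun_q) w = mat 1" "hecke_word r (V1111 ratfun_q) w = mat 1"
    using m[of "V31 laurent_q"] m[of "V22 laurent_q"] m[of "V211 laurent_q"] m[of "V1111 laurent_q"]
    by (simp_all add: map_V q triv V22_trivial[OF w triv] V211_trivial[OF w triv]
      V1111_trivial[OF w triv] map_matrix_mat one)
qed

section \<open>Values of the representations on words\<close>

abbreviation word_class :: "nat \<Rightarrow> (nat \<times> bool) list \<Rightarrow> (nat \<times> bool) list set" where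
  "word_class n w \<equiv> group_cong {1..<n} (braid_group_relations n) `` {w}"

text \<open>A homomorphism on the braid group is determined by its values on the generators; the class of
  an inverse letter is the inverse of a generator because the two letters cancel.\<close>
lemma hom_word_class:
  assumes "group H" "h \<in> hom (braid_group n) H" "w \<in> group_words {1..<n}"
  shows "h (word_class n w) = word_eval H (\<lambda>i. h (braid_gen n i)) w"
  using assms(3)
proof (induction w)
  interpret H: group H by fact
  interpret B: group "braid_group n" by (rule braid_group_is_group)
  interpret h: group_hom "braid_group n" H h
    by unfold_locales (rule assms(2))
  have one: "\<one>\<^bsub>braid_group n\<^esub> = word_class n []"
    by (simp add: braid_group_def presented_group_def)
  {
    case Nil
    show ?case using h.hom_one by (simp add: one word_eval_def)
  next
    case (Cons l w)
    obtain s e where l: "l = (s, e)" by (cases l)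
    have s: "s \<in> {1..<n}" using Cons.prems l by simp
    have carr: "word_class n u \<in> carrier (braid_group n)" if "u \<in> group_words {1..<n}" for u
      unfolding braid_group_def using that by (rule presented_carrierI)
    have mult: "word_class n (u @ v) = word_class n u \<otimes>\<^bsub>braid_group n\<^esub> word_class n v"
      if "u \<in> group_words {1..<n}" "v \<in> group_words {1..<n}" for u v
      unfolding braid_group_def using that by (rule presented_mult[symmetric])
    have "([] @ [(s, False), (s, \<not> False)] @ [], [] @ []) \<in> group_cong {1..<n} (braid_group_relations n)"
      using s by (intro group_cong.cancel) auto
    then have "word_class n ([(s, False)] @ [(s, True)]) = \<one>\<^bsub>braid_group n\<^esub>"
      unfolding one by (intro group_cong_class_eq) simp
    then have "word_class n [(s, False)] = inv\<^bsub>braid_group n\<^esub> (word_class n [(s, True)])"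
      using s by (intro B.inv_equality[symmetric]) (simp_all add: carr del: One_nat_def flip: mult)
    then have "h (word_class n [l])
        = (if e then h (braid_gen n s) else inv\<^bsub>H\<^esub> (h (braid_gen n s)))"
      using s by (simp add: l braid_gen_def presented_gen_def carr del: One_nat_def)
    moreover have "h (word_class n (l # w)) = h (word_class n [l]) \<otimes>\<^bsub>H\<^esub> h (word_class n w)"
      using Cons.prems mult[of "[l]" w] by (simp add: carr del: One_nat_def)
    ultimately show ?case using Cons by (simp add: l word_eval_def)
  }
qed

lemma word_eval_cong_gen:
  assumes "\<And>i. i \<in> {1..<n} \<Longrightarrow> f i = g i" "w \<in> group_words {1..<n}"
  shows "word_eval H f w = word_eval H g w"
  using assms(2) by (induction w) (auto simp: word_eval_def assms(1))

lemma burau_word: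
  assumes "w \<in> group_words {1..<4}"
  shows "burau_rep (word_class 4 w) = hecke_word laurent_q_inv (V31 laurent_q) w"
proof -
  let ?G = "GL TYPE(laurent) TYPE(3)"
  interpret group ?G by (rule group_GL)
  have inv: "inv\<^bsub>?G\<^esub> (burau_matrix i) = mat laurent_q_inv ** V31 laurent_q i + mat (1 - laurent_q_inv)"
    (is "_ = ?B") for i
  proof -
    have "V31 laurent_q i ** ?B = mat 1" "?B ** V31 laurent_q i = mat 1"
      by (simp_all add: V31_def matrix_entry_simps laurent_q_qpow algebra_simps qpow_mult qpow_0)
    moreover from this have "invertible ?B" "invertible (V31 laurent_q i)"
      unfolding invertible_def by blast+
    ultimately show ?thesis
      by (intro inv_equality) (simp_all add: GL_def burau_matrix_V31)
  qed
  have "word_eval ?G (\<lambda>i. burau_rep (braid_gen 4 i)) w = word_eval ?G burau_matrix w"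
    by (rule word_eval_cong_gen[OF burau_rep_gen assms])
  also have "\<dots> = hecke_word laurent_q_inv (V31 laurent_q) w"
  proof (induction w)
    case Nil
    show ?case by (simp add: word_eval_def GL_def)
  next
    case (Cons l w)
    have m: "A \<otimes>\<^bsub>?G\<^esub> B = A ** B" for A B by (simp add: GL_def)
    show ?case
      using Cons by (cases l) (simp add: word_eval_def hecke_letter_def inv m burau_matrix_V31[symmetric])
  qed
  finally show ?thesis
    using hom_word_class[OF group_GL burau_rep_hom assms] by simp
qed

lemma scalar_add: "scalar (c + d) = scalar c + scalar d"
  by (simp add: scalar_def single_add)

lemma scalar_diff: "scalar (c - d) = scalar c - scalar d"
  by (simp add: scalar_def single_diff)

lemma scalar_minus: "scalar (- c) = - scalar c"
  by (simp add: scalar_def single_uminus)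

lemma scalar_zero: "scalar 0 = 0"
  by (simp add: scalar_def)

lemma scalar_sum: "scalar (sum f A) = (\<Sum>i\<in>A. scalar (f i))"
  by (induction A rule: infinite_finite_induct) (simp_all add: scalar_add scalar_zero)

lemma scalar_left_commute: "p * (scalar c * p') = scalar c * (p * p')"
  by (metis mult.assoc scalar_commute)

text \<open>The inverse letter is lifted to the free algebra by the formula used for matrices, so that it
  inverts the generator modulo the Hecke ideal.\<close>
definition free_letter :: "nat \<times> bool \<Rightarrow> (nat list \<Rightarrow>\<^sub>0 ratfun)" where
  "free_letter l = (if snd l then word_monom [fst l]
     else scalar (inverse ratfun_q) * word_monom [fst l] + scalar (1 - inverse ratfun_q))"

definition free_word :: "(nat \<times> bool) list \<Rightarrow> (nat list \<Rightarrow>\<^sub>0 ratfun)" where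
  "free_word w = foldr (\<lambda>l p. free_letter l * p) w 1"

lemma free_word_simps [simp]:
  "free_word [] = 1" "free_word (l # w) = free_letter l * free_word w"
  by (simp_all add: free_word_def)

lemma free_letter_carrier: "fst l \<in> S \<Longrightarrow> free_letter l \<in> carrier (free_algebra S)"
  by (auto simp: free_letter_def intro!: free_algebra_closed word_monom_carrier scalar_carrier)

lemma free_word_carrier: "w \<in> group_words S \<Longrightarrow> free_word w \<in> carrier (free_algebra S)"
  by (induction w)
    (auto intro!: free_algebra_closed(2) free_letter_carrier free_algebra_closed(4)[OF scalar_carrier scalar_carrier])

lemma free_letter_inverse:
  "free_letter (i, False) * word_monom [i] - 1
    = scalar (inverse ratfun_q) * ((word_monom [i] - 1) * (word_monom [i] + scalar ratfun_q))"
proof -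
  define x :: "nat list \<Rightarrow>\<^sub>0 ratfun" where "x = word_monom [i]"
  define q r :: "nat list \<Rightarrow>\<^sub>0 ratfun" where "q = scalar ratfun_q" and "r = scalar (inverse ratfun_q)"
  have rq: "r * q = 1"
    by (simp add: q_def r_def scalar_mult scalar_one ratfun_q_nonzero)
  have "x * q = q * x"
    unfolding q_def by (rule scalar_commute[symmetric])
  then have rxq: "r * (x * q) = x"
    by (metis mult.assoc mult_1_left rq)
  have "(r * x + (1 - r)) * x - 1 = r * (x * x) + r * (x * q) - r * x - r * q"
    by (simp add: rq rxq distrib_right left_diff_distrib mult.assoc)
  also have "\<dots> = r * ((x - 1) * (x + q))"
    by (simp add: distrib_left distrib_right left_diff_distrib right_diff_distrib)
  finally have "(r * x + (1 - r)) * x - 1 = r * ((x - 1) * (x + q))" .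
  then show ?thesis
    by (simp add: free_letter_def scalar_diff scalar_one x_def q_def r_def)
qed

lemma ideal_times:
  assumes "x \<in> hecke_ideal n" "p \<in> carrier (free_algebra {1..<n})"
  shows "p * x \<in> hecke_ideal n" "x * p \<in> hecke_ideal n"
  using ideal.I_l_closed[OF ideal_hecke_ideal assms] ideal.I_r_closed[OF ideal_hecke_ideal assms]
  by (simp_all add: free_algebra_def del: One_nat_def)

lemma hecke_one: "\<one>\<^bsub>hecke_algebra n\<^esub> = hecke_ideal n +>\<^bsub>free_algebra {1..<n}\<^esub> 1"
  by (simp add: hecke_algebra_def FactRing_def) (simp add: free_algebra_def)

text \<open>This moves the Jones representation from cosets to the free algebra, where a braid word is
  sent to 1 exactly if its lift is congruent to 1 modulo the Hecke ideal.\<close>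
lemma jones_word:
  assumes "w \<in> group_words {1..<n}"
  shows "jones_rep n (word_class n w) = hecke_ideal n +>\<^bsub>free_algebra {1..<n}\<^esub> free_word w"
proof -
  let ?H = "hecke_algebra n" and ?U = "units_of (hecke_algebra n)"
  let ?\<pi> = "\<lambda>p. hecke_ideal n +>\<^bsub>free_algebra {1..<n}\<^esub> p"
  interpret H: ring ?H by (rule ring_hecke_algebra)
  interpret U: group ?U by (rule H.units_group)
  have inv: "inv\<^bsub>?U\<^esub> (hecke_gen n i) = ?\<pi> (free_letter (i, False))" if "i \<in> {1..<n}" for i
  proof -
    let ?y = "free_letter (i, False)" and ?x = "word_monom [i] :: nat list \<Rightarrow>\<^sub>0 ratfun"
    have c: "?x \<in> carrier (free_algebra {1..<n})" "?y \<in> carrier (free_algebra {1..<n})"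
      using that by (auto intro!: word_monom_carrier free_letter_carrier)
    have "(?x - 1) * (?x + scalar ratfun_q) \<in> hecke_ideal n"
      using that by (intro subsetD[OF hecke_relators_ideal]) (auto simp: hecke_relators_def)
    then have "?y * ?x - 1 \<in> hecke_ideal n"
      unfolding free_letter_inverse by (rule ideal_times) (rule scalar_carrier)
    then have "?\<pi> (?y * ?x) = ?\<pi> 1"
      by (intro hecke_coset_eq free_algebra_closed c) (rule c)+
    then have yx: "?\<pi> ?y \<otimes>\<^bsub>?H\<^esub> hecke_gen n i = \<one>\<^bsub>?H\<^esub>"
      by (simp only: hecke_gen_def hecke_mult[OF c(2,1)] hecke_one)
    have "?\<pi> ?y = inv\<^bsub>?H\<^esub> (hecke_gen n i)"
      using H.inv_unique[OF yx, of "inv\<^bsub>?H\<^esub> (hecke_gen n i)"] hecke_gen_unit[OF that] hecke_carrier[OF c(2)]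
      by (simp add: H.Units_closed)
    then show ?thesis
      using H.units_of_inv[OF hecke_gen_unit[OF that]] by simp
  qed
  have "word_eval ?U (\<lambda>i. jones_rep n (braid_gen n i)) w = word_eval ?U (hecke_gen n) w"
    by (rule word_eval_cong_gen[OF jones_rep_gen assms])
  also have "\<dots> = ?\<pi> (free_word w)"
    using assms
  proof (induction w)
    case Nil
    show ?case by (simp add: word_eval_def units_of_one hecke_one)
  next
    case (Cons l w)
    obtain i e where l: "l = (i, e)" by (cases l)
    have i: "i \<in> {1..<n}" and w: "w \<in> group_words {1..<n}" using Cons.prems by (simp_all add: l)
    have "(if e then hecke_gen n i else inv\<^bsub>?U\<^esub> (hecke_gen n i)) = ?\<pi> (free_letter l)"
      using inv[OF i] by (simp add: l) (simp add: hecke_gen_def free_letter_def)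
    then have "word_eval ?U (hecke_gen n) (l # w) = ?\<pi> (free_letter l) \<otimes>\<^bsub>?H\<^esub> ?\<pi> (free_word w)"
      using Cons.IH[OF w] by (simp add: l word_eval_def units_of_mult)
    also have "\<dots> = ?\<pi> (free_word (l # w))"
      using i w by (simp add: hecke_mult free_letter_carrier free_word_carrier l del: One_nat_def)
    finally show ?case .
  qed
  finally show ?thesis
    using hom_word_class[OF U.is_group jones_rep_hom assms] by simp
qed

section \<open>The Burau representation as a representation of the Temperley-Lieb algebra\<close>

definition monomial_matrix :: "(nat \<Rightarrow> ratfun ^ 'n ^ 'n) \<Rightarrow> nat list \<Rightarrow> ratfun ^ 'n ^ 'n" where
  "monomial_matrix V u = foldr (\<lambda>i A. V i ** A) u (mat 1)"

lemma monomial_matrix_append: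
  "monomial_matrix V (u @ v) = monomial_matrix V u ** monomial_matrix V v"
  by (induction u) (simp_all add: monomial_matrix_def matrix_mul_assoc)

definition free_eval :: "(nat \<Rightarrow> ratfun ^ 'n ^ 'n) \<Rightarrow> (nat list \<Rightarrow>\<^sub>0 ratfun) \<Rightarrow> ratfun ^ 'n ^ 'n" where
  "free_eval V = additive_extension (\<lambda>u c. mat c ** monomial_matrix V u)"

definition matrix_ring :: "('a::ring_1 ^ 'n ^ 'n) ring" where
  "matrix_ring = \<lparr>carrier = UNIV, Group.monoid.mult = (**), one = mat 1, zero = 0, add = (+)\<rparr>"

lemma ring_matrix_ring: "ring (matrix_ring :: ('a::ring_1 ^ 'n ^ 'n) ring)"
proof (rule ringI)
  show "abelian_group (matrix_ring :: ('a ^ 'n ^ 'n) ring)"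
    by (rule abelian_groupI)
      (auto simp: matrix_ring_def algebra_simps intro: exI[of _ "- x" for x])
  show "Group.monoid (matrix_ring :: ('a ^ 'n ^ 'n) ring)"
    by (rule monoidI) (auto simp: matrix_ring_def matrix_mul_assoc)
qed (auto simp: matrix_ring_def matrix_add_mult matrix_add_ldistrib)

lemma free_eval_simps:
  "free_eval V (p + p') = free_eval V p + free_eval V p'"
  "free_eval V (p * p') = free_eval V p ** free_eval V p'"
  "free_eval V 1 = mat 1" "free_eval V (scalar c) = mat c"
  "free_eval V (word_monom u) = monomial_matrix V u"
  "free_eval V (p - p') = free_eval V p - free_eval V p'"
proof -
  let ?F = "\<lambda>u c. mat c ** monomial_matrix V u"
  have F: "additive_coeffs ?F"
    by (simp add: additive_coeffs_def vec_eq_iff mat_mult_nth distrib_right)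
  show add: "free_eval V (p + p') = free_eval V p + free_eval V p'" for p p'
    unfolding free_eval_def by (rule additive_coeffs.extension_add[OF F])
  have "mat (c * d) ** monomial_matrix V (u + v)
      = (mat c ** monomial_matrix V u) ** (mat d ** monomial_matrix V v)" for c d u v
    unfolding matrix_mult_middle mat_central[of "monomial_matrix V u" d]
    by (simp add: plus_list_def monomial_matrix_append matrix_mul_assoc mat_mult_mat)
  then show "free_eval V (p * p') = free_eval V p ** free_eval V p'"
    unfolding free_eval_def
    by (intro additive_extension_mult[OF F]) (simp_all add: matrix_add_mult matrix_add_ldistrib)
  have single: "free_eval V (Poly_Mapping.single u c) = ?F u c" for u c
    unfolding free_eval_def by (rule additive_coeffs.extension_single[OF F])
  show scalar: "free_eval V (scalar c) = mat c" for c
    by (simp add: scalar_def single monomial_matrix_def)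
  show "free_eval V 1 = mat 1"
    using scalar[of 1] by (simp only: scalar_one)
  show "free_eval V (word_monom u) = monomial_matrix V u"
    by (simp add: word_monom_def single)
  show "free_eval V (p - p') = free_eval V p - free_eval V p'"
    using add[of "p - p'" p'] by (simp add: algebra_simps)
qed

lemma free_eval_hom: "free_eval V \<in> ring_hom (free_algebra S) matrix_ring"
  by (rule ring_hom_memI) (auto simp: free_algebra_def matrix_ring_def free_eval_simps)

lemma free_eval_word: "free_eval V (free_word w) = hecke_word (inverse ratfun_q) V w"
proof (induction w)
  case Nil
  show ?case by (simp add: free_eval_simps)
next
  case (Cons l w)
  have "free_eval V (free_letter l) = hecke_letter (inverse ratfun_q) V l"
    by (simp add: free_letter_def hecke_letter_def free_eval_simps monomial_matrix_def)
  then show ?case using Cons by (simp add: free_eval_simps)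
qed

lemma V31_braid:
  "V31 q (Suc 0) ** (V31 q 2 ** V31 q (Suc 0)) = V31 q 2 ** (V31 q (Suc 0) ** V31 q 2)"
  "V31 q 2 ** (V31 q 3 ** V31 q 2) = V31 q 3 ** (V31 q 2 ** V31 q 3)"
  "V31 q (Suc 0) ** V31 q 3 = V31 q 3 ** V31 q (Suc 0)"
  by (simp_all add: V31_def matrix_entry_simps algebra_simps)

text \<open>The kernel of the evaluation is a two-sided ideal, so it is enough to check the relators.\<close>
lemma V31_eval_hecke_ideal:
  assumes "p \<in> hecke_ideal 4"
  shows "free_eval (V31 ratfun_q) p = 0"
proof -
  let ?F = "free_algebra {1..<4} :: (nat list \<Rightarrow>\<^sub>0 ratfun) ring" and ?ev = "free_eval (V31 ratfun_q)"
  interpret F: ring ?F by (rule ring_free_algebra)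
  interpret ring_hom_ring ?F "matrix_ring :: (ratfun ^ 3 ^ 3) ring" ?ev
    by (rule ring_hom_ringI2[OF ring_free_algebra ring_matrix_ring free_eval_hom])
  have ker: "a_kernel ?F matrix_ring ?ev = {p \<in> carrier ?F. ?ev p = 0}"
    unfolding a_kernel_def' by (simp add: matrix_ring_def)
  have "?ev x = 0" if "x \<in> hecke_relators 4" for x
  proof -
    from that consider (braid) u v where "x = word_monom u - word_monom v" "(u, v) \<in> braid_relations 4"
      | (quad) i where "x = (word_monom [i] - 1) * (word_monom [i] + scalar ratfun_q)" "i \<in> {1..<4}"
      unfolding hecke_relators_def by blast
    then show ?thesis
    proof cases
      case braid
      have "(u = [1, 2, 1] \<and> v = [2, 1, 2]) \<or> (u = [2, 3, 2] \<and> v = [3, 2, 3]) \<or>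
        (u = [1, 3] \<and> v = [3, 1]) \<or> (u = [3, 1] \<and> v = [1, 3])"
      proof -
        from braid(2) consider i where "1 \<le> i" "i + 1 < 4" "u = [i, i + 1, i]" "v = [i + 1, i, i + 1]"
          | i j where "i \<in> {1..<4}" "j \<in> {1..<4}" "\<bar>int i - int j\<bar> \<ge> 2" "u = [i, j]" "v = [j, i]"
          by (auto simp: braid_relations_def)
        then show ?thesis
        proof cases
          case 1
          then have "i = 1 \<or> i = 2" by auto
          then show ?thesis using 1 by auto
        next
          case 2
          then have "i = 1 \<and> j = 3 \<or> i = 3 \<and> j = 1" by auto
          then show ?thesis using 2 by auto
        qed
      qed
      then have "monomial_matrix (V31 ratfun_q) u = monomial_matrix (V31 ratfun_q) v"
        by (elim disjE conjE) (simp_all add: monomial_matrix_def V31_braid)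
      then show ?thesis
        by (simp add: braid(1) free_eval_simps)
    next
      case quad
      have "?ev x = (V31 ratfun_q i - mat 1) ** (V31 ratfun_q i + mat ratfun_q)"
        by (simp add: quad(1) free_eval_simps monomial_matrix_def)
      moreover from quad(2) have "(V31 ratfun_q i - mat 1) ** (V31 ratfun_q i + mat ratfun_q) = 0"
        by (cases rule: less4_cases) (simp_all add: V31_def matrix_entry_simps algebra_simps)
      ultimately show ?thesis by simp
    qed
  qed
  then have "hecke_relators 4 \<subseteq> a_kernel ?F matrix_ring ?ev"
    unfolding ker using hecke_relators_carrier[of 4] by blast
  then have "hecke_ideal 4 \<subseteq> a_kernel ?F matrix_ring ?ev"
    unfolding hecke_ideal_def by (rule F.genideal_minimal[OF kernel_is_ideal])
  then show ?thesis
    using assms unfolding ker by blast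
qed

text \<open>Evaluation at the Burau matrices is constant on cosets of the Hecke ideal, so the image of a
  coset is a singleton.\<close>
definition hecke_V31 :: "(nat list \<Rightarrow>\<^sub>0 ratfun) set \<Rightarrow> ratfun ^ 3 ^ 3" where
  "hecke_V31 X = the_elem (free_eval (V31 ratfun_q) ` X)"

lemma hecke_V31_coset:
  assumes "p \<in> carrier (free_algebra {1..<4})"
  shows "hecke_V31 (hecke_ideal 4 +>\<^bsub>free_algebra {1..<4}\<^esub> p) = free_eval (V31 ratfun_q) p"
proof -
  let ?F = "free_algebra {1..<4} :: (nat list \<Rightarrow>\<^sub>0 ratfun) ring"
  interpret ideal "hecke_ideal 4" ?F by (rule ideal_hecke_ideal)
  have "p \<in> hecke_ideal 4 +>\<^bsub>?F\<^esub> p" by (rule a_rcos_self[OF assms])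
  moreover have "free_eval (V31 ratfun_q) p' = free_eval (V31 ratfun_q) p"
    if "p' \<in> hecke_ideal 4 +>\<^bsub>?F\<^esub> p" for p'
    using that V31_eval_hecke_ideal
    by (auto simp: a_r_coset_def' free_algebra_def free_eval_simps)
  ultimately have "free_eval (V31 ratfun_q) ` (hecke_ideal 4 +>\<^bsub>?F\<^esub> p) = {free_eval (V31 ratfun_q) p}"
    by blast
  then show ?thesis by (simp only: hecke_V31_def the_elem_eq)
qed

lemma hecke_carrierE:
  assumes "X \<in> carrier (hecke_algebra n)"
  obtains p where "p \<in> carrier (free_algebra {1..<n})" "X = hecke_ideal n +>\<^bsub>free_algebra {1..<n}\<^esub> p"
  using assms by (auto simp: hecke_algebra_def FactRing_def A_RCOSETS_def')

lemma hecke_V31_hom: "hecke_V31 \<in> ring_hom (hecke_algebra 4) matrix_ring"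
proof (rule ring_hom_memI)
  let ?F = "free_algebra {1..<4} :: (nat list \<Rightarrow>\<^sub>0 ratfun) ring"
  interpret ideal "hecke_ideal 4" ?F by (rule ideal_hecke_ideal)
  note rcos = rcos_ring_hom[folded hecke_algebra_def]
  fix X Y assume "X \<in> carrier (hecke_algebra 4)" "Y \<in> carrier (hecke_algebra 4)"
  then obtain x y where x: "x \<in> carrier ?F" "X = hecke_ideal 4 +>\<^bsub>?F\<^esub> x"
    and y: "y \<in> carrier ?F" "Y = hecke_ideal 4 +>\<^bsub>?F\<^esub> y"
    using hecke_carrierE by metis
  show "hecke_V31 (X \<otimes>\<^bsub>hecke_algebra 4\<^esub> Y) = hecke_V31 X \<otimes>\<^bsub>matrix_ring\<^esub> hecke_V31 Y"
    unfolding x y hecke_mult[OF x(1) y(1)] hecke_V31_coset[OF x(1)] hecke_V31_coset[OF y(1)]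
      hecke_V31_coset[OF free_algebra_closed(2)[OF x(1) y(1)]]
    by (simp add: matrix_ring_def free_eval_simps)
  have "X \<oplus>\<^bsub>hecke_algebra 4\<^esub> Y = hecke_ideal 4 +>\<^bsub>?F\<^esub> (x + y)"
    using ring_hom_add[OF rcos x(1) y(1)] by (simp only: x y) (simp add: free_algebra_def)
  then show "hecke_V31 (X \<oplus>\<^bsub>hecke_algebra 4\<^esub> Y) = hecke_V31 X \<oplus>\<^bsub>matrix_ring\<^esub> hecke_V31 Y"
    unfolding x y hecke_V31_coset[OF x(1)] hecke_V31_coset[OF y(1)]
    by (simp only: hecke_V31_coset[OF free_algebra_closed(1)[OF x(1) y(1)]])
      (simp add: matrix_ring_def free_eval_simps)
next
  show "hecke_V31 \<one>\<^bsub>hecke_algebra 4\<^esub> = \<one>\<^bsub>matrix_ring\<^esub>"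
    unfolding hecke_one hecke_V31_coset[OF free_algebra_closed(4)[OF scalar_carrier scalar_carrier]]
    by (simp add: matrix_ring_def free_eval_simps)
qed (simp add: matrix_ring_def)

text \<open>The Temperley-Lieb element generates the summands with three or more rows. That it vanishes in
  the Burau representation is a matrix identity, and the kernel is an ideal.\<close>
lemma hecke_V31_TL_ideal:
  assumes "X \<in> TL_ideal 4"
  shows "hecke_V31 X = 0"
proof -
  let ?H = "hecke_algebra 4"
  interpret H: ring ?H by (rule ring_hecke_algebra)
  interpret h: ring_hom_ring ?H "matrix_ring :: (ratfun ^ 3 ^ 3) ring" hecke_V31
    by (rule ring_hom_ringI2[OF ring_hecke_algebra ring_matrix_ring hecke_V31_hom])
  have ker: "a_kernel ?H matrix_ring hecke_V31 = {X \<in> carrier ?H. hecke_V31 X = 0}"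
    unfolding a_kernel_def' by (simp add: matrix_ring_def)
  have g: "hecke_gen 4 i \<in> carrier ?H" "hecke_V31 (hecke_gen 4 i) = V31 ratfun_q i" if "i \<in> {1..<4}" for i
  proof -
    have m: "word_monom [i] \<in> carrier (free_algebra {1..<4} :: (nat list \<Rightarrow>\<^sub>0 ratfun) ring)"
      using that by (intro word_monom_carrier) auto
    show "hecke_gen 4 i \<in> carrier ?H" unfolding hecke_gen_def by (rule hecke_carrier[OF m])
    show "hecke_V31 (hecke_gen 4 i) = V31 ratfun_q i"
      unfolding hecke_gen_def hecke_V31_coset[OF m]
      by (simp add: free_eval_simps monomial_matrix_def)
  qed
  have minus: "A \<ominus>\<^bsub>matrix_ring\<^esub> B = A - B" for A B :: "ratfun ^ 3 ^ 3"
  proof -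
    have "\<ominus>\<^bsub>matrix_ring\<^esub> B = - B"
      by (rule abelian_group.minus_equality[OF ring.is_abelian_group[OF ring_matrix_ring]]) (simp_all add: matrix_ring_def)
    then show ?thesis by (simp add: a_minus_def) (simp add: matrix_ring_def)
  qed
  have h_minus: "hecke_V31 (X \<ominus>\<^bsub>?H\<^esub> Y) = hecke_V31 X - hecke_V31 Y"
    if "X \<in> carrier ?H" "Y \<in> carrier ?H" for X Y
    using that by (simp add: a_minus_def minus[symmetric])
  have g': "hecke_gen 4 1 \<in> carrier ?H" "hecke_gen 4 2 \<in> carrier ?H"
    "hecke_V31 (hecke_gen 4 1) = V31 ratfun_q 1" "hecke_V31 (hecke_gen 4 2) = V31 ratfun_q 2"
    by (intro g; simp)+
  have "hecke_V31 (TL_element 4) = mat 1 - V31 ratfun_q 1 - V31 ratfun_q 2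
      + V31 ratfun_q 1 ** V31 ratfun_q 2 + V31 ratfun_q 2 ** V31 ratfun_q 1
      - V31 ratfun_q 1 ** V31 ratfun_q 2 ** V31 ratfun_q 1"
    using g' by (simp add: TL_element_def Let_def h_minus del: One_nat_def) (simp add: matrix_ring_def)
  also have "\<dots> = 0"
    by (simp add: V31_def matrix_entry_simps algebra_simps)
  finally have "hecke_V31 (TL_element 4) = 0" .
  then have "{TL_element 4} \<subseteq> a_kernel ?H matrix_ring hecke_V31"
    unfolding ker using TL_element_carrier[of 4] by simp
  then have "TL_ideal 4 \<subseteq> a_kernel ?H matrix_ring hecke_V31"
    unfolding TL_ideal_def by (rule H.genideal_minimal[OF h.kernel_is_ideal])
  then show ?thesis
    using assms unfolding ker by blast
qed

section \<open>Left ideals of the Hecke algebra as matrix representations\<close>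

lemma hecke_ideal_closed:
  "0 \<in> hecke_ideal n" "x \<in> hecke_ideal n \<Longrightarrow> y \<in> hecke_ideal n \<Longrightarrow> x + y \<in> hecke_ideal n"
  "x \<in> hecke_ideal n \<Longrightarrow> - x \<in> hecke_ideal n"
proof -
  interpret ideal "hecke_ideal n" "free_algebra {1..<n}" by (rule ideal_hecke_ideal)
  show "0 \<in> hecke_ideal n" "x \<in> hecke_ideal n \<Longrightarrow> y \<in> hecke_ideal n \<Longrightarrow> x + y \<in> hecke_ideal n"
    using additive_subgroup.zero_closed[OF additive_subgroup_axioms]
      additive_subgroup.a_closed[OF additive_subgroup_axioms]
    by (simp_all add: free_algebra_def)
  assume x: "x \<in> hecke_ideal n"
  have "scalar (- 1) * x \<in> hecke_ideal n"
    by (rule ideal_times[OF x scalar_carrier])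
  then show "- x \<in> hecke_ideal n" by (simp add: scalar_minus scalar_one)
qed

text \<open>Working with congruences in the free algebra keeps the ring operations of its type and avoids
  the operations on cosets.\<close>
definition hecke_cong :: "(nat list \<Rightarrow>\<^sub>0 ratfun) \<Rightarrow> (nat list \<Rightarrow>\<^sub>0 ratfun) \<Rightarrow> bool" (infix "\<approx>" 50) where
  "p \<approx> p' \<longleftrightarrow> p - p' \<in> hecke_ideal 4"

abbreviation "free4 \<equiv> carrier (free_algebra {1..<4} :: (nat list \<Rightarrow>\<^sub>0 ratfun) ring)"

lemma hecke_cong_refl [simp]: "p \<approx> p"
  by (simp add: hecke_cong_def hecke_ideal_closed)

lemma hecke_cong_sym: "p \<approx> p' \<Longrightarrow> p' \<approx> p"
  using hecke_ideal_closed(3)[of "p - p'" 4] by (simp add: hecke_cong_def)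

lemma hecke_cong_trans [trans]: "p \<approx> p' \<Longrightarrow> p' \<approx> p'' \<Longrightarrow> p \<approx> p''"
  using hecke_ideal_closed(2)[of "p - p'" 4 "p' - p''"] by (simp add: hecke_cong_def)

lemma hecke_cong_add: "p \<approx> p' \<Longrightarrow> r \<approx> r' \<Longrightarrow> p + r \<approx> p' + r'"
  using hecke_ideal_closed(2)[of "p - p'" 4 "r - r'"] by (simp add: hecke_cong_def algebra_simps)

lemma hecke_cong_sum: "(\<And>s. s \<in> A \<Longrightarrow> p s \<approx> p' s) \<Longrightarrow> sum p A \<approx> sum p' A"
  by (induction A rule: infinite_finite_induct) (simp_all add: hecke_cong_add)

lemma hecke_cong_left: "p \<approx> p' \<Longrightarrow> x \<in> free4 \<Longrightarrow> x * p \<approx> x * p'"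
  unfolding hecke_cong_def right_diff_distrib[symmetric] by (rule ideal_times)

lemma hecke_cong_right: "p \<approx> p' \<Longrightarrow> x \<in> free4 \<Longrightarrow> p * x \<approx> p' * x"
  unfolding hecke_cong_def left_diff_distrib[symmetric] by (rule ideal_times)

lemma free_letter_action:
  fixes x :: "'n::finite \<Rightarrow> (nat list \<Rightarrow>\<^sub>0 ratfun)"
  assumes act: "\<And>i t. i \<in> {1..<4} \<Longrightarrow> word_monom [i] * x t \<approx> (\<Sum>s\<in>UNIV. scalar (A i $ s $ t) * x s)"
    and l: "fst l \<in> {1..<4}"
  shows "free_letter l * x t \<approx> (\<Sum>s\<in>UNIV. scalar (hecke_letter (inverse ratfun_q) A l $ s $ t) * x s)"
proof (cases "snd l")
  case True
  then show ?thesis using act[OF l] by (simp add: free_letter_def hecke_letter_def)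
next
  case False
  let ?r = "inverse ratfun_q"
  have "free_letter l * x t = scalar ?r * (word_monom [fst l] * x t) + scalar (1 - ?r) * x t"
    using False by (simp add: free_letter_def distrib_right mult.assoc)
  also have "\<dots> \<approx> scalar ?r * (\<Sum>s\<in>UNIV. scalar (A (fst l) $ s $ t) * x s) + scalar (1 - ?r) * x t"
    by (intro hecke_cong_add hecke_cong_left act[OF l] scalar_carrier hecke_cong_refl)
  also have "scalar (1 - ?r) * x t = (\<Sum>s\<in>UNIV. scalar (mat (1 - ?r) $ s $ t) * x s)"
  proof -
    have "(\<Sum>s\<in>UNIV. scalar (mat (1 - ?r) $ s $ t) * x s)
        = (\<Sum>s\<in>UNIV. if s = t then scalar (1 - ?r) * x t else 0)"
      by (rule sum.cong) (simp_all add: mat_def scalar_zero)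
    then show ?thesis by simp
  qed
  also have "scalar ?r * (\<Sum>s\<in>UNIV. scalar (A (fst l) $ s $ t) * x s) + \<dots>
      = (\<Sum>s\<in>UNIV. scalar (hecke_letter ?r A l $ s $ t) * x s)"
    using False
    by (simp add: hecke_letter_def sum_distrib_left scalar_add mat_mult_nth distrib_right
        scalar_mult[symmetric] mult.assoc sum.distrib)
  finally show ?thesis .
qed

text \<open>If the generators act on a family \<open>x\<close> modulo the Hecke ideal by matrices, then so does every
  braid word. In particular a word whose matrix fixes a basis vector fixes the corresponding
  element of the Hecke algebra.\<close>
lemma free_word_action:
  fixes x :: "'n::finite \<Rightarrow> (nat list \<Rightarrow>\<^sub>0 ratfun)"
  assumes act: "\<And>i t. i \<in> {1..<4} \<Longrightarrow> word_monom [i] * x t \<approx> (\<Sum>s\<in>UNIV. scalar (A i $ s $ t) * x s)"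
    and w: "w \<in> group_words {1..<4}"
  shows "free_word w * x t \<approx> (\<Sum>s\<in>UNIV. scalar (hecke_word (inverse ratfun_q) A w $ s $ t) * x s)"
  using w
proof (induction w)
  case Nil
  have "(\<Sum>s\<in>UNIV. scalar (mat 1 $ s $ t) * x s) = (\<Sum>s\<in>UNIV. if s = t then x t else 0)"
    by (rule sum.cong) (auto simp: mat_def scalar_one scalar_zero)
  then show ?case by simp
next
  case (Cons l w)
  let ?L = "hecke_letter (inverse ratfun_q) A l" and ?W = "hecke_word (inverse ratfun_q) A w"
  have l: "fst l \<in> {1..<4}" and w: "w \<in> group_words {1..<4}" using Cons.prems by simp_all
  have "free_word (l # w) * x t = free_letter l * (free_word w * x t)"
    by (simp add: mult.assoc)
  also have "\<dots> \<approx> free_letter l * (\<Sum>s\<in>UNIV. scalar (?W $ s $ t) * x s)"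
    by (intro hecke_cong_left Cons.IH w free_letter_carrier l)
  also have "\<dots> = (\<Sum>s\<in>UNIV. scalar (?W $ s $ t) * (free_letter l * x s))"
    by (simp add: sum_distrib_left scalar_left_commute)
  also have "\<dots> \<approx> (\<Sum>s\<in>UNIV. scalar (?W $ s $ t) * (\<Sum>u\<in>UNIV. scalar (?L $ u $ s) * x u))"
    by (intro hecke_cong_sum hecke_cong_left free_letter_action[OF act l] scalar_carrier) simp_all
  also have "\<dots> = (\<Sum>s\<in>UNIV. \<Sum>u\<in>UNIV. scalar (?L $ u $ s * ?W $ s $ t) * x u)"
    by (simp add: sum_distrib_left scalar_mult mult.commute flip: mult.assoc)
  also have "\<dots> = (\<Sum>u\<in>UNIV. \<Sum>s\<in>UNIV. scalar (?L $ u $ s * ?W $ s $ t) * x u)"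
    by (rule sum.swap)
  also have "\<dots> = (\<Sum>u\<in>UNIV. scalar (hecke_word (inverse ratfun_q) A (l # w) $ u $ t) * x u)"
    by (simp add: matrix_matrix_mult_def sum_distrib_right scalar_sum)
  finally show ?case .
qed

section \<open>Modules induced from the commuting generators\<close>

text \<open>The six minimal representatives of the left cosets of \<open>\<langle>s\<^sub>1, s\<^sub>3\<rangle>\<close> in the symmetric group on four
  letters, named by their reduced words: \<open>S132\<close> stands for \<open>s\<^sub>1 s\<^sub>3 s\<^sub>2\<close>.\<close>
datatype shuffle = S0 | S2 | S12 | S32 | S132 | S2132

lemma UNIV_shuffle: "UNIV = {S0, S2, S12, S32, S132, S2132}"
  using shuffle.exhaust by blast

instance shuffle :: finite
  by standard (simp add: UNIV_shuffle)

lemma sum_shuffle: "sum f UNIV = f S0 + f S2 + f S12 + f S32 + f S132 + f S2132"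
  by (simp add: UNIV_shuffle add.assoc)

lemma forall_shuffle: "(\<forall>s. P s) \<longleftrightarrow> P S0 \<and> P S2 \<and> P S12 \<and> P S32 \<and> P S132 \<and> P S2132"
  by (metis shuffle.exhaust)

text \<open>The module induced from the character \<open>g\<^sub>1 \<mapsto> a\<close>, \<open>g\<^sub>3 \<mapsto> c\<close> of the parabolic subalgebra
  generated by \<open>g\<^sub>1\<close> and \<open>g\<^sub>3\<close>: the coordinates of \<open>g\<^sub>i\<close> applied to the basis vector \<open>t\<close>. If
  \<open>s\<^sub>i t\<close> is longer, it is either again a representative or equal to \<open>t s\<close> with \<open>s\<close> in the
  parabolic subgroup, which contributes \<open>a\<close> or \<open>c\<close>; if it is shorter, the quadratic relation
  applies.\<close>
definition induced_column :: "'a::comm_ring_1 \<Rightarrow> 'a \<Rightarrow> 'a \<Rightarrow> nat \<Rightarrow> shuffle \<Rightarrow> shuffle \<Rightarrow> 'a" where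
  "induced_column q a c i t =
     (if i = 1 then case t of
        S0 \<Rightarrow> (\<lambda>_. 0)(S0 := a)
      | S2 \<Rightarrow> (\<lambda>_. 0)(S12 := 1)
      | S12 \<Rightarrow> (\<lambda>_. 0)(S2 := q, S12 := 1 - q)
      | S32 \<Rightarrow> (\<lambda>_. 0)(S132 := 1)
      | S132 \<Rightarrow> (\<lambda>_. 0)(S32 := q, S132 := 1 - q)
      | S2132 \<Rightarrow> (\<lambda>_. 0)(S2132 := c)
      else if i = 2 then case t of
        S0 \<Rightarrow> (\<lambda>_. 0)(S2 := 1)
      | S2 \<Rightarrow> (\<lambda>_. 0)(S0 := q, S2 := 1 - q)
      | S12 \<Rightarrow> (\<lambda>_. 0)(S12 := a)
      | S32 \<Rightarrow> (\<lambda>_. 0)(S32 := c)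
      | S132 \<Rightarrow> (\<lambda>_. 0)(S2132 := 1)
      | S2132 \<Rightarrow> (\<lambda>_. 0)(S132 := q, S2132 := 1 - q)
      else case t of
        S0 \<Rightarrow> (\<lambda>_. 0)(S0 := c)
      | S2 \<Rightarrow> (\<lambda>_. 0)(S32 := 1)
      | S12 \<Rightarrow> (\<lambda>_. 0)(S132 := 1)
      | S32 \<Rightarrow> (\<lambda>_. 0)(S2 := q, S32 := 1 - q)
      | S132 \<Rightarrow> (\<lambda>_. 0)(S12 := q, S132 := 1 - q)
      | S2132 \<Rightarrow> (\<lambda>_. 0)(S2132 := a))"

definition induced :: "'a::comm_ring_1 \<Rightarrow> 'a \<Rightarrow> 'a \<Rightarrow> nat \<Rightarrow> 'a ^ shuffle ^ shuffle" where
  "induced q a c i = (\<chi> s t. induced_column q a c i t s)"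

definition shuffle_rows :: "'a ^ 'n \<Rightarrow> 'a ^ 'n \<Rightarrow> 'a ^ 'n \<Rightarrow> 'a ^ 'n \<Rightarrow> 'a ^ 'n \<Rightarrow> 'a ^ 'n \<Rightarrow> 'a ^ 'n ^ shuffle" where
  "shuffle_rows v0 v2 v12 v32 v132 v2132 = (\<chi> s. case s of
     S0 \<Rightarrow> v0 | S2 \<Rightarrow> v2 | S12 \<Rightarrow> v12 | S32 \<Rightarrow> v32 | S132 \<Rightarrow> v132 | S2132 \<Rightarrow> v2132)"

lemmas induced_simps = induced_def induced_column_def shuffle_rows_def V4_def V31_def V22_def V211_def
  V1111_def Finite_Cartesian_Product.transpose_def matrix_entry_simps forall_shuffle sum_shuffle

lemma fixed_vector:
  assumes "\<And>i. i \<in> {1..<4} \<Longrightarrow> A i ** P = P ** V i" "w \<in> group_words {1..<4}"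
    and "hecke_word r V w = mat 1"
  shows "hecke_word r A w *v (P *v p) = P *v p"
  using hecke_word_intertwine[OF assms(1,2), where r = r] assms(3)
  by (simp add: matrix_vector_mul_assoc)

lemma fixed_scaled:
  fixes W :: "'a::field ^ 'n ^ 'n"
  assumes "W *v v' = v'" "v' = D *s v" "D \<noteq> 0"
  shows "W *v v = v"
  using assms by (simp add: vector_scalar_commute vec_eq_iff)

context
  fixes q r :: "'a::field" and w :: "(nat \<times> bool) list"
  assumes w: "w \<in> group_words {1..<4}"
    and trivial: "hecke_word r (V31 q) w = mat 1" "hecke_word r (V22 q) w = mat 1"
      "hecke_word r (V211 q) w = mat 1" "hecke_word r (V1111 q) w = mat 1"
    and nonzero: "q \<noteq> 0" "1 + q \<noteq> 0" "1 + q ^ 2 \<noteq> 0" "1 + q + q ^ 2 \<noteq> 0"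
begin

text \<open>In each of the four cases the matrices \<open>P\<close> embed the representations that occur in the induced
  module; over \<open>\<rat>(q)\<close> each is, up to a factor, the unique solution of the linear equations
  \<open>A\<^sub>i P = P V\<^sub>i\<close>. The vectors \<open>p\<close> solve \<open>\<Sum> P p = D e\<close>, where \<open>e\<close> is the generator \<open>S0\<close> and \<open>D\<close> a common denominator.
  Here the module contains \<open>V\<^sub>4\<close>, \<open>V\<^sub>3\<^sub>1\<close> and \<open>V\<^sub>2\<^sub>2\<close>.\<close>
lemma induced_trivial_trivial:
  "hecke_word r (induced q 1 1) w *v axis S0 1 = axis S0 1"
proof (rule fixed_scaled)
  define P4 :: "'a ^ 1 ^ shuffle" where "P4 = shuffle_rows (vector [q^4]) (vector [q^3])
    (vector [q^2]) (vector [q^2]) (vector [q]) (vector [1])"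
  define P31 :: "'a ^ 3 ^ shuffle" where "P31 = shuffle_rows (vector [0, - (q^2), 0])
    (vector [- q, q^2, - (q^2)]) (vector [q, 0, - q]) (vector [- 1, 0, q^2])
    (vector [1, - 1, q]) (vector [0, 1, 0])"
  define P22 :: "'a ^ 2 ^ shuffle" where "P22 = shuffle_rows (vector [0, q]) (vector [1, - q])
    (vector [- 1, 0]) (vector [- 1, 0]) (vector [1, - 1]) (vector [0, 1])"
  define p4 :: "'a ^ 1" where "p4 = vector [q * (1 + q)]"
  define p31 :: "'a ^ 3" where "p31 = - (1 + q + q^2) *s vector [q, 1 + q, 1]"
  define p22 :: "'a ^ 2" where "p22 = (1 + q^2) *s vector [q, 1 + q]"
  have inter: "induced q 1 1 i ** P4 = P4 ** V4 q i" "induced q 1 1 i ** P31 = P31 ** V31 q i"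
    "induced q 1 1 i ** P22 = P22 ** V22 q i" if "i \<in> {1..<4}" for i
    using that by (cases rule: less4_cases;
      simp add: P4_def P31_def P22_def induced_simps algebra_simps power_numeral_reduce)+
  have "hecke_word r (induced q 1 1) w *v (P4 *v p4) = P4 *v p4"
    by (rule fixed_vector[OF inter(1) w hecke_word_V4])
  moreover have "hecke_word r (induced q 1 1) w *v (P31 *v p31) = P31 *v p31"
    by (rule fixed_vector[OF inter(2) w trivial(1)])
  moreover have "hecke_word r (induced q 1 1) w *v (P22 *v p22) = P22 *v p22"
    by (rule fixed_vector[OF inter(3) w trivial(2)])
  ultimately show "hecke_word r (induced q 1 1) w *v (P4 *v p4 + P31 *v p31 + P22 *v p22)
      = P4 *v p4 + P31 *v p31 + P22 *v p22"
    by (simp add: matrix_vector_right_distrib)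
  show "P4 *v p4 + P31 *v p31 + P22 *v p22
      = (q * (1 + q) * (1 + q^2) * (1 + q + q^2)) *s axis S0 1"
    by (simp add: P4_def P31_def P22_def p4_def p31_def p22_def induced_simps matrix_vector_mult_def
        axis_def algebra_simps power_numeral_reduce)
qed (use nonzero in simp)

lemma induced_trivial_sign:
  "hecke_word r (induced q 1 (- q)) w *v axis S0 1 = axis S0 1"
proof (rule fixed_scaled)
  define P31 :: "'a ^ 3 ^ shuffle" where "P31 = shuffle_rows (vector [0, q^4, - (q^4) - q^5])
    (vector [q^3, - (q^4), - (q^3)]) (vector [- (q^3), 0, - (q^2)]) (vector [q^2, - (q^2) - q^3, q^3])
    (vector [- (q^2), - q, q^2]) (vector [- 1 - q, q, 0])"
  define P211 :: "'a ^ 3 ^ shuffle" where "P211 = shuffle_rows (vector [q^2, 0, 0])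
    (vector [- (q^2), - q, 0]) (vector [0, q, 0]) (vector [q^2, q, 1])
    (vector [0, - q, - 1]) (vector [0, 0, 1])"
  define p31 :: "'a ^ 3" where "p31 = vector [0, 0, - 1]"
  define p211 :: "'a ^ 3" where "p211 = vector [1 + q, - q, 0]"
  have inter: "induced q 1 (- q) i ** P31 = P31 ** V31 q i" "induced q 1 (- q) i ** P211 = P211 ** V211 q i"
    if "i \<in> {1..<4}" for i
    using that by (cases rule: less4_cases;
      simp add: P31_def P211_def induced_simps algebra_simps power_numeral_reduce)+
  have "hecke_word r (induced q 1 (- q)) w *v (P31 *v p31) = P31 *v p31"
    by (rule fixed_vector[OF inter(1) w trivial(1)])
  moreover have "hecke_word r (induced q 1 (- q)) w *v (P211 *v p211) = P211 *v p211"
    by (rule fixed_vector[OF inter(2) w trivial(3)])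
  ultimately show "hecke_word r (induced q 1 (- q)) w *v (P31 *v p31 + P211 *v p211) = P31 *v p31 + P211 *v p211"
    by (simp add: matrix_vector_right_distrib)
  show "P31 *v p31 + P211 *v p211 = (q^2 * (1 + q) * (1 + q^2)) *s axis S0 1"
    by (simp add: P31_def P211_def p31_def p211_def induced_simps matrix_vector_mult_def
        axis_def algebra_simps power_numeral_reduce)
qed (use nonzero in simp)

lemma induced_sign_trivial:
  "hecke_word r (induced q (- q) 1) w *v axis S0 1 = axis S0 1"
proof (rule fixed_scaled)
  define P31 :: "'a ^ 3 ^ shuffle" where "P31 = shuffle_rows (vector [q^2 + q^3, - (q^3), 0])
    (vector [q, q^3, - (q^3)]) (vector [- q, q + q^2, - (q^2)]) (vector [1, 0, q^3])
    (vector [- 1, 1, q^2]) (vector [0, - 1, 1 + q])"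
  define P211 :: "'a ^ 3 ^ shuffle" where "P211 = shuffle_rows (vector [0, 0, 1])
    (vector [0, - 1, - 1]) (vector [1, 1, 1]) (vector [0, 1, 0])
    (vector [- 1, - 1, 0]) (vector [1, 0, 0])"
  define p31 :: "'a ^ 3" where "p31 = vector [1, 0, 0]"
  define p211 :: "'a ^ 3" where "p211 = vector [0, - 1, 1 + q]"
  have inter: "induced q (- q) 1 i ** P31 = P31 ** V31 q i" "induced q (- q) 1 i ** P211 = P211 ** V211 q i"
    if "i \<in> {1..<4}" for i
    using that by (cases rule: less4_cases;
      simp add: P31_def P211_def induced_simps algebra_simps power_numeral_reduce)+
  have "hecke_word r (induced q (- q) 1) w *v (P31 *v p31) = P31 *v p31"
    by (rule fixed_vector[OF inter(1) w trivial(1)])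
  moreover have "hecke_word r (induced q (- q) 1) w *v (P211 *v p211) = P211 *v p211"
    by (rule fixed_vector[OF inter(2) w trivial(3)])
  ultimately show "hecke_word r (induced q (- q) 1) w *v (P31 *v p31 + P211 *v p211) = P31 *v p31 + P211 *v p211"
    by (simp add: matrix_vector_right_distrib)
  show "P31 *v p31 + P211 *v p211 = ((1 + q) * (1 + q^2)) *s axis S0 1"
    by (simp add: P31_def P211_def p31_def p211_def induced_simps matrix_vector_mult_def
        axis_def algebra_simps power_numeral_reduce)
qed (use nonzero in simp)

lemma induced_sign_sign:
  "hecke_word r (induced q (- q) (- q)) w *v axis S0 1 = axis S0 1"
proof (rule fixed_scaled)
  define P22 :: "'a ^ 2 ^ shuffle" where "P22 = shuffle_rows (vector [- (q^3) - q^4, q^4])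
    (vector [- (q^2), - (q^4)]) (vector [q^2, - (q^2) - q^3]) (vector [q^2, - (q^2) - q^3])
    (vector [- (q^2), - q]) (vector [- 1 - q, q])"
  define P211 :: "'a ^ 3 ^ shuffle" where "P211 = shuffle_rows (vector [- (q^3), - (q^2) - q^3, - (q^2)])
    (vector [q^3, - q + q^2, q^2]) (vector [q, q - q^2, - (q^2)]) (vector [- (q^3), q - q^2, 1])
    (vector [- q, - q + q^2, - 1]) (vector [q, 1 + q, 1])"
  define P1111 :: "'a ^ 1 ^ shuffle" where "P1111 = shuffle_rows (vector [1]) (vector [- 1])
    (vector [1]) (vector [1]) (vector [- 1]) (vector [1])"
  define p22 :: "'a ^ 2" where "p22 = vector [- (1 + q^2), 0]"
  define p211 :: "'a ^ 3" where "p211 = vector [0, - (1 + q + q^2), 0]"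
  define p1111 :: "'a ^ 1" where "p1111 = vector [q * (1 + q)]"
  have inter: "induced q (- q) (- q) i ** P22 = P22 ** V22 q i"
    "induced q (- q) (- q) i ** P211 = P211 ** V211 q i"
    "induced q (- q) (- q) i ** P1111 = P1111 ** V1111 q i" if "i \<in> {1..<4}" for i
    using that by (cases rule: less4_cases;
      simp add: P22_def P211_def P1111_def induced_simps algebra_simps power_numeral_reduce)+
  have "hecke_word r (induced q (- q) (- q)) w *v (P22 *v p22) = P22 *v p22"
    by (rule fixed_vector[OF inter(1) w trivial(2)])
  moreover have "hecke_word r (induced q (- q) (- q)) w *v (P211 *v p211) = P211 *v p211"
    by (rule fixed_vector[OF inter(2) w trivial(3)])
  moreover have "hecke_word r (induced q (- q) (- q)) w *v (P1111 *v p1111) = P1111 *v p1111"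
    by (rule fixed_vector[OF inter(3) w trivial(4)])
  ultimately show "hecke_word r (induced q (- q) (- q)) w *v (P22 *v p22 + P211 *v p211 + P1111 *v p1111)
      = P22 *v p22 + P211 *v p211 + P1111 *v p1111"
    by (simp add: matrix_vector_right_distrib)
  show "P22 *v p22 + P211 *v p211 + P1111 *v p1111
      = (q * (1 + q) * (1 + q^2) * (1 + q + q^2)) *s axis S0 1"
    by (simp add: P22_def P211_def P1111_def p22_def p211_def p1111_def induced_simps
        matrix_vector_mult_def axis_def algebra_simps power_numeral_reduce)
qed (use nonzero in simp)

end

definition shuffle_elt :: "(nat list \<Rightarrow>\<^sub>0 ratfun) \<Rightarrow> shuffle \<Rightarrow> (nat list \<Rightarrow>\<^sub>0 ratfun)" where
  "shuffle_elt f t = (case t of S0 \<Rightarrow> f | S2 \<Rightarrow> word_monom [2] * f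
     | S12 \<Rightarrow> word_monom [1] * (word_monom [2] * f) | S32 \<Rightarrow> word_monom [3] * (word_monom [2] * f)
     | S132 \<Rightarrow> word_monom [1] * (word_monom [3] * (word_monom [2] * f))
     | S2132 \<Rightarrow> word_monom [2] * (word_monom [1] * (word_monom [3] * (word_monom [2] * f))))"

lemma gen_carrier: "word_monom [1] \<in> free4" "word_monom [2] \<in> free4" "word_monom [3] \<in> free4"
  by (auto intro!: word_monom_carrier)

lemma hecke_quadratic:
  assumes "i \<in> {1..<4}" "y \<in> free4"
  shows "word_monom [i] * (word_monom [i] * y)
    \<approx> scalar ratfun_q * y + scalar (1 - ratfun_q) * (word_monom [i] * y)"
proof -
  let ?g = "word_monom [i] :: nat list \<Rightarrow>\<^sub>0 ratfun" and ?q = "scalar ratfun_q :: nat list \<Rightarrow>\<^sub>0 ratfun"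
  have "(?g - 1) * (?g + ?q) \<in> hecke_ideal 4"
    using assms(1) by (intro subsetD[OF hecke_relators_ideal]) (auto simp: hecke_relators_def)
  then have "(?g - 1) * (?g + ?q) * y \<in> hecke_ideal 4"
    using assms(2) by (rule ideal_times)
  moreover have "?g * (?q * y) = ?q * (?g * y)" by (rule scalar_left_commute)
  then have "(?g - 1) * (?g + ?q) * y
      = ?g * (?g * y) - (?q * y + scalar (1 - ratfun_q) * (?g * y))"
    by (simp add: scalar_diff scalar_one distrib_left distrib_right left_diff_distrib
        right_diff_distrib mult.assoc)
  ultimately show ?thesis by (simp add: hecke_cong_def)
qed

lemma hecke_braid:
  assumes "y \<in> free4"
  shows "word_monom [1] * (word_monom [2] * (word_monom [1] * y))
      \<approx> word_monom [2] * (word_monom [1] * (word_monom [2] * y))"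
    "word_monom [2] * (word_monom [3] * (word_monom [2] * y))
      \<approx> word_monom [3] * (word_monom [2] * (word_monom [3] * y))"
    "word_monom [3] * (word_monom [1] * y) \<approx> word_monom [1] * (word_monom [3] * y)"
proof -
  have rel: "word_monom u * y \<approx> word_monom v * y" if "(u, v) \<in> braid_relations 4" for u v
  proof (rule hecke_cong_right[OF _ assms])
    show "word_monom u \<approx> word_monom v"
      unfolding hecke_cong_def using that
      by (intro subsetD[OF hecke_relators_ideal]) (auto simp: hecke_relators_def)
  qed
  have "([1, 1 + 1, 1], [1 + 1, 1, 1 + 1]) \<in> braid_relations 4"
    "([2, 2 + 1, 2], [2 + 1, 2, 2 + 1]) \<in> braid_relations 4" "([3, 1], [1, 3]) \<in> braid_relations 4"
    unfolding braid_relations_def by auto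
  then have "word_monom [1, 2, 1] * y \<approx> word_monom [2, 1, 2] * y"
    "word_monom [2, 3, 2] * y \<approx> word_monom [3, 2, 3] * y" "word_monom [3, 1] * y \<approx> word_monom [1, 3] * y"
    using rel by (metis one_add_one, metis numeral_plus_one semiring_norm(5) add_One, metis)
  moreover have "word_monom [i, j, k] * y = word_monom [i] * (word_monom [j] * (word_monom [k] * y))"
    "word_monom [i, j] * y = word_monom [i] * (word_monom [j] * y)" for i j k
    by (simp_all add: word_monom_mult flip: mult.assoc)
  ultimately show "word_monom [1] * (word_monom [2] * (word_monom [1] * y))
      \<approx> word_monom [2] * (word_monom [1] * (word_monom [2] * y))"
    "word_monom [2] * (word_monom [3] * (word_monom [2] * y))
      \<approx> word_monom [3] * (word_monom [2] * (word_monom [3] * y))"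
    "word_monom [3] * (word_monom [1] * y) \<approx> word_monom [1] * (word_monom [3] * y)"
    by simp_all
qed

text \<open>Besides the quadratic relation, the cases use that a braid relation moves a generator through
  the word until it reaches \<open>f\<close>, where it acts by its eigenvalue.\<close>
lemma shuffle_elt_action:
  assumes f: "f \<in> free4" and f1: "word_monom [1] * f \<approx> scalar a * f"
    and f3: "word_monom [3] * f \<approx> scalar c * f" and i: "i \<in> {1..<4}"
  shows "word_monom [i] * shuffle_elt f t
    \<approx> (\<Sum>s\<in>UNIV. scalar (induced ratfun_q a c i $ s $ t) * shuffle_elt f s)"
proof -
  define g1 g2 g3 :: "nat list \<Rightarrow>\<^sub>0 ratfun" where "g1 = word_monom [1]" and "g2 = word_monom [2]"
    and "g3 = word_monom [3]"
  note gs = g1_def[symmetric] g2_def[symmetric] g3_def[symmetric] 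
  let ?q = "scalar ratfun_q" and ?q' = "scalar (1 - ratfun_q)"
  have g: "g1 \<in> free4" "g2 \<in> free4" "g3 \<in> free4"
    unfolding g1_def g2_def g3_def by (rule gen_carrier)+
  note [intro] = g f free_algebra_closed(2)[OF g(1)] free_algebra_closed(2)[OF g(2)]
    free_algebra_closed(2)[OF g(3)] scalar_carrier
  have quad: "g1 * (g1 * y) \<approx> ?q * y + ?q' * (g1 * y)" "g2 * (g2 * y) \<approx> ?q * y + ?q' * (g2 * y)"
    "g3 * (g3 * y) \<approx> ?q * y + ?q' * (g3 * y)" if "y \<in> free4" for y
    unfolding g1_def g2_def g3_def by (rule hecke_quadratic[OF _ that]; simp)+
  note braid = hecke_braid[folded g1_def g2_def g3_def]
  note f1 = f1[folded g1_def] and f3 = f3[folded g3_def]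
  have 212: "g2 * (g1 * (g2 * f)) \<approx> scalar a * (g1 * (g2 * f))"
  proof -
    have "g2 * (g1 * (g2 * f)) \<approx> g1 * (g2 * (g1 * f))"
      by (rule hecke_cong_sym[OF braid(1)[OF f]])
    also have "\<dots> \<approx> g1 * (g2 * (scalar a * f))"
      by (intro hecke_cong_left f1 g)
    finally show ?thesis by (simp only: scalar_left_commute)
  qed
  have 232: "g2 * (g3 * (g2 * f)) \<approx> scalar c * (g3 * (g2 * f))"
  proof -
    have "g2 * (g3 * (g2 * f)) \<approx> g3 * (g2 * (g3 * f))"
      by (rule braid(2)[OF f])
    also have "\<dots> \<approx> g3 * (g2 * (scalar c * f))"
      by (intro hecke_cong_left f3 g)
    finally show ?thesis by (simp only: scalar_left_commute)
  qed
  have 312: "g3 * (g1 * (g2 * f)) \<approx> g1 * (g3 * (g2 * f))"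
    by (rule braid(3)) blast
  have 3132: "g3 * (g1 * (g3 * (g2 * f))) \<approx> ?q * (g1 * (g2 * f)) + ?q' * (g1 * (g3 * (g2 * f)))"
  proof -
    have "g3 * (g1 * (g3 * (g2 * f))) \<approx> g1 * (g3 * (g3 * (g2 * f)))"
      by (rule braid(3)) blast
    also have "\<dots> \<approx> g1 * (?q * (g2 * f) + ?q' * (g3 * (g2 * f)))"
      by (intro hecke_cong_left quad g) blast
    finally show ?thesis by (simp only: distrib_left scalar_left_commute)
  qed
  have 12132: "g1 * (g2 * (g1 * (g3 * (g2 * f)))) \<approx> scalar c * (g2 * (g1 * (g3 * (g2 * f))))"
  proof -
    have "g1 * (g2 * (g1 * (g3 * (g2 * f)))) \<approx> g2 * (g1 * (g2 * (g3 * (g2 * f))))"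
      by (rule braid(1)) blast
    also have "\<dots> \<approx> g2 * (g1 * (scalar c * (g3 * (g2 * f))))"
      by (intro hecke_cong_left 232 g)
    finally show ?thesis by (simp only: scalar_left_commute)
  qed
  have 32132: "g3 * (g2 * (g1 * (g3 * (g2 * f)))) \<approx> scalar a * (g2 * (g1 * (g3 * (g2 * f))))"
  proof -
    have "g3 * (g2 * (g1 * (g3 * (g2 * f)))) \<approx> g3 * (g2 * (g3 * (g1 * (g2 * f))))"
      by (intro hecke_cong_left g hecke_cong_sym[OF 312])
    also have "\<dots> \<approx> g2 * (g3 * (g2 * (g1 * (g2 * f))))"
      by (rule hecke_cong_sym[OF braid(2)]) blast
    also have "\<dots> \<approx> g2 * (g3 * (scalar a * (g1 * (g2 * f))))"
      by (intro hecke_cong_left 212 g)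
    also have "\<dots> = scalar a * (g2 * (g3 * (g1 * (g2 * f))))"
      by (simp only: scalar_left_commute)
    also have "\<dots> \<approx> scalar a * (g2 * (g1 * (g3 * (g2 * f))))"
      by (intro hecke_cong_left 312 g scalar_carrier)
    finally show ?thesis .
  qed
  have quads: "g1 * (g1 * (g2 * f)) \<approx> ?q * (g2 * f) + ?q' * (g1 * (g2 * f))"
    "g1 * (g1 * (g3 * (g2 * f))) \<approx> ?q * (g3 * (g2 * f)) + ?q' * (g1 * (g3 * (g2 * f)))"
    "g2 * (g2 * f) \<approx> ?q * f + ?q' * (g2 * f)"
    "g2 * (g2 * (g1 * (g3 * (g2 * f)))) \<approx> ?q * (g1 * (g3 * (g2 * f))) + ?q' * (g2 * (g1 * (g3 * (g2 * f))))"
    "g3 * (g3 * (g2 * f)) \<approx> ?q * (g2 * f) + ?q' * (g3 * (g2 * f))"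
    by (rule quad; blast)+
  note rules = f1 f3 212 232 312 3132 12132 32132 quads
  from i show ?thesis
    by (cases rule: less4_cases; cases t)
      (simp_all add: shuffle_elt_def induced_def induced_column_def sum_shuffle scalar_zero scalar_one
        gs rules del: One_nat_def)
qed

lemma hecke_eigenvector:
  assumes "{a, b} = {1, - ratfun_q}" "i \<in> {1..<4}" "z \<in> free4"
  shows "word_monom [i] * ((word_monom [i] - scalar b) * z) \<approx> scalar a * ((word_monom [i] - scalar b) * z)"
proof -
  let ?g = "word_monom [i] :: nat list \<Rightarrow>\<^sub>0 ratfun" and ?q = "scalar ratfun_q :: nat list \<Rightarrow>\<^sub>0 ratfun"
  have "(?g - 1) * (?g + ?q) \<in> hecke_ideal 4"
    using assms(2) by (intro subsetD[OF hecke_relators_ideal]) (auto simp: hecke_relators_def)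
  then have "(?g - 1) * (?g + ?q) * z \<in> hecke_ideal 4"
    using assms(3) by (rule ideal_times)
  moreover have "(?g - 1) * (?g + ?q) = (?g - scalar a) * (?g - scalar b)"
  proof -
    have "a = 1 \<and> b = - ratfun_q \<or> a = - ratfun_q \<and> b = 1"
      using assms(1) by (auto simp: doubleton_eq_iff)
    moreover have "?g * ?q = ?q * ?g" by (rule scalar_commute[symmetric])
    ultimately show ?thesis
      by (auto simp: scalar_minus scalar_one distrib_left distrib_right left_diff_distrib right_diff_distrib)
  qed
  ultimately have "(?g - scalar a) * (?g - scalar b) * z \<in> hecke_ideal 4"
    by simp
  moreover have "(?g - x) * y * z = ?g * (y * z) - x * (y * z)" for x y
    by (simp add: left_diff_distrib mult.assoc)
  ultimately show ?thesis
    by (simp only: hecke_cong_def)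
qed

lemma ratfun_nonzero:
  "1 + ratfun_q \<noteq> 0" "1 + ratfun_q ^ 2 \<noteq> 0" "1 + ratfun_q + ratfun_q ^ 2 \<noteq> 0"
proof -
  have "1 + ratfun_q = to_fract [:1, 1:]" "1 + ratfun_q ^ 2 = to_fract [:1, 0, 1:]"
    "1 + ratfun_q + ratfun_q ^ 2 = to_fract [:1, 1, 1:]"
    by (simp_all add: ratfun_q_to_fract power2_eq_square to_fract_1[symmetric]
        to_fract_add[symmetric] to_fract_mult[symmetric] one_pCons del: to_fract_1 to_fract_add to_fract_mult)
  then show "1 + ratfun_q \<noteq> 0" "1 + ratfun_q ^ 2 \<noteq> 0" "1 + ratfun_q + ratfun_q ^ 2 \<noteq> 0"
    by simp_all
qed

text \<open>The four products \<open>f b d\<close> are fixed by the word on the left, and their signed sum is the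
  invertible scalar \<open>(q + 1)\<^sup>2\<close>.\<close>
lemma free_word_trivial:
  assumes w: "w \<in> group_words {1..<4}" and triv: "hecke_word laurent_q_inv (V31 laurent_q) w = mat 1"
  shows "free_word w \<approx> 1"
proof -
  let ?q = ratfun_q and ?r = "inverse ratfun_q"
  let ?g1 = "word_monom [1] :: nat list \<Rightarrow>\<^sub>0 ratfun" and ?g3 = "word_monom [3] :: nat list \<Rightarrow>\<^sub>0 ratfun"
  \<comment> \<open>Since \<open>(g - a) (g - b) = 0\<close>, removing the root \<open>b\<close> leaves an eigenvector for the other root \<open>a\<close>.\<close>
  define f where "f b d = (?g1 - scalar b) * (?g3 - scalar d)" for b d
  have fixed: "free_word w * f b d \<approx> f b d"
    if ab: "{a, b} = {1, - ?q}" and cd: "{c, d} = {1, - ?q}"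
      and W: "hecke_word ?r (induced ?q a c) w *v axis S0 1 = axis S0 1" for a b c d
  proof -
    have c1: "?g1 - scalar b \<in> free4" and c3: "?g3 - scalar d \<in> free4"
      by (intro free_algebra_closed gen_carrier scalar_carrier)+
    then have f: "f b d \<in> free4" unfolding f_def by (rule free_algebra_closed)
    have f1: "?g1 * f b d \<approx> scalar a * f b d"
      unfolding f_def by (rule hecke_eigenvector[OF ab _ c3]) simp
    have f3: "?g3 * f b d \<approx> scalar c * f b d"
    proof -
      have "?g3 * f b d = ?g3 * (?g1 * (?g3 - scalar d)) + scalar (- b) * (?g3 * (?g3 - scalar d))"
        by (simp add: f_def left_diff_distrib right_diff_distrib[of ?g3] scalar_left_commute scalar_minus)
      also have "\<dots> \<approx> ?g1 * (?g3 * (?g3 - scalar d)) + scalar (- b) * (?g3 * (?g3 - scalar d))"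
        by (intro hecke_cong_add hecke_braid(3) c3 hecke_cong_refl)
      also have "\<dots> = (?g1 - scalar b) * (?g3 * (?g3 - scalar d))"
        by (simp add: left_diff_distrib scalar_minus)
      also have "\<dots> \<approx> (?g1 - scalar b) * (scalar c * (?g3 - scalar d))"
        using hecke_eigenvector[OF cd, of 3 1] free_algebra_closed(4)[OF c1 c1]
        by (intro hecke_cong_left c1) simp
      also have "\<dots> = scalar c * f b d"
        by (simp add: f_def scalar_left_commute)
      finally show ?thesis .
    qed
    have "free_word w * shuffle_elt (f b d) S0
        \<approx> (\<Sum>s\<in>UNIV. scalar (hecke_word ?r (induced ?q a c) w $ s $ S0) * shuffle_elt (f b d) s)"
      by (rule free_word_action[OF shuffle_elt_action[OF f f1 f3] w])
    moreover have "hecke_word ?r (induced ?q a c) w $ s $ S0 = (if s = S0 then 1 else 0)" for s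
      using arg_cong[OF W, of "\<lambda>v. v $ s"]
      by (simp add: matrix_vector_mult_def axis_def if_distrib cong: if_cong)
    ultimately show ?thesis
      by (simp add: sum_shuffle scalar_zero scalar_one shuffle_elt_def)
  qed
  note trivial = ratfun_words_trivial[OF w triv]
  note induced = induced_trivial_trivial induced_trivial_sign induced_sign_trivial induced_sign_sign
  note induced = induced[OF w trivial ratfun_q_nonzero ratfun_nonzero]
  have p: "{1, - ?q} = {1, - ?q}" and m: "{- ?q, 1} = {1, - ?q}" by auto
  have "free_word w * f (- ?q) (- ?q) \<approx> f (- ?q) (- ?q)" "free_word w * f (- ?q) 1 \<approx> f (- ?q) 1"
    "free_word w * f 1 (- ?q) \<approx> f 1 (- ?q)" "free_word w * f 1 1 \<approx> f 1 1"
    by (fact fixed[OF p p induced(1)] fixed[OF p m induced(2)] fixed[OF m p induced(3)]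
      fixed[OF m m induced(4)])+
  moreover have "- f b d = scalar (- 1) * f b d" for b d
    by (simp add: scalar_minus scalar_one)
  ultimately have "free_word w * f (- ?q) (- ?q) + scalar (- 1) * (free_word w * f (- ?q) 1)
      + scalar (- 1) * (free_word w * f 1 (- ?q)) + free_word w * f 1 1
    \<approx> f (- ?q) (- ?q) + scalar (- 1) * f (- ?q) 1 + scalar (- 1) * f 1 (- ?q) + f 1 1" (is "?l \<approx> ?e")
    by (intro hecke_cong_add hecke_cong_left scalar_carrier)
  moreover have "?l = free_word w * ?e"
    by (simp only: distrib_left scalar_left_commute)
  moreover have "?e = (scalar ?q + 1) * (scalar ?q + 1)"
    by (simp add: f_def scalar_minus scalar_one algebra_simps)
  then have "?e = scalar ((?q + 1) * (?q + 1))"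
    by (simp only: scalar_mult[symmetric] scalar_add scalar_one)
  ultimately have "free_word w * scalar ((?q + 1) * (?q + 1)) \<approx> scalar ((?q + 1) * (?q + 1))" (is "?u \<approx> ?v")
    by simp
  then have "?u * scalar (inverse ((?q + 1) * (?q + 1))) \<approx> ?v * scalar (inverse ((?q + 1) * (?q + 1)))"
    by (rule hecke_cong_right[OF _ scalar_carrier])
  moreover have "(?q + 1) * (?q + 1) * inverse ((?q + 1) * (?q + 1)) = 1"
    using ratfun_nonzero(1) by (intro right_inverse) (simp add: add.commute)
  ultimately show ?thesis
    by (simp only: mult.assoc[of "free_word w"] scalar_mult scalar_one mult_1_right)
qed

section \<open>The equivalence\<close>

text \<open>A braid in the Burau kernel is trivial in the Hecke algebra, hence trivial if the Jones
  representation is faithful.\<close>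
lemma faithful_jones_imp_faithful_burau:
  assumes "faithful (braid_group 4) (jones_rep 4)"
  shows "faithful (braid_group 4) burau_rep"
proof -
  let ?U = "units_of (hecke_algebra 4)" and ?G = "GL TYPE(laurent) TYPE(3)"
  interpret H: ring "hecke_algebra 4" by (rule ring_hecke_algebra)
  interpret burau: group_hom "braid_group 4" ?G burau_rep
    by (intro group_hom.intro group_hom_axioms.intro braid_group_is_group group_GL burau_rep_hom)
  interpret jones: group_hom "braid_group 4" ?U "jones_rep 4"
    by (intro group_hom.intro group_hom_axioms.intro braid_group_is_group H.units_group jones_rep_hom)
  have "X = \<one>\<^bsub>braid_group 4\<^esub>" if X: "X \<in> carrier (braid_group 4)" "burau_rep X = \<one>\<^bsub>?G\<^esub>" for X
  proof -
    from X(1) obtain w where w: "w \<in> group_words {1..<4}" "X = word_class 4 w"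
      unfolding braid_group_def by (rule presented_carrierE)
    have "hecke_word laurent_q_inv (V31 laurent_q) w = mat 1"
      using X(2) unfolding w(2) burau_word[OF w(1)] by (simp add: GL_def)
    then have "free_word w - 1 \<in> hecke_ideal 4"
      using free_word_trivial[OF w(1)] by (simp only: hecke_cong_def)
    then have "jones_rep 4 X = \<one>\<^bsub>?U\<^esub>"
      unfolding w(2) jones_word[OF w(1)] units_of_one hecke_one
      by (intro hecke_coset_eq free_word_carrier w(1) free_algebra_closed(4)[OF scalar_carrier scalar_carrier])
    then show ?thesis
      using assms X(1) unfolding faithful_def jones.inj_on_one_iff by blast
  qed
  then show ?thesis
    unfolding faithful_def burau.inj_on_one_iff by blast
qed

lemma faithful_TL_imp_faithful_jones:
  assumes "faithful (braid_group n) (TL_rep n)"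
  shows "faithful (braid_group n) (jones_rep n)"
  using assms unfolding faithful_def TL_rep_def by (auto simp: inj_on_def)

lemma hecke_V31_jones:
  assumes "X \<in> carrier (braid_group 4)"
  shows "hecke_V31 (jones_rep 4 X) = map_matrix (laurent_eval ratfun_q) (burau_rep X)"
proof -
  interpret comm_ring_hom "laurent_eval ratfun_q"
    by (rule comm_ring_hom_laurent_eval) (rule ratfun_q_nonzero)
  from assms obtain w where w: "w \<in> group_words {1..<4}" "X = word_class 4 w"
    unfolding braid_group_def by (rule presented_carrierE)
  have q: "laurent_eval ratfun_q laurent_q = ratfun_q" "laurent_eval ratfun_q laurent_q_inv = inverse ratfun_q"
    by (simp_all add: laurent_q_def qpow_def laurent_eval_single)
  show ?thesis
    unfolding w(2) burau_word[OF w(1)] jones_word[OF w(1)] hecke_V31_coset[OF free_word_carrier[OF w(1)]]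
    by (simp add: free_eval_word map_matrix_hecke_word map_V q)
qed

text \<open>Elements of the Hecke algebra that agree modulo the Temperley-Lieb ideal have the same Burau
  matrix over \<open>\<rat>(q)\<close>, and the passage from Laurent polynomials to rational functions is
  injective.\<close>
lemma faithful_burau_imp_faithful_TL:
  assumes "faithful (braid_group 4) burau_rep"
  shows "faithful (braid_group 4) (TL_rep 4)"
  unfolding faithful_def
proof (rule inj_onI)
  fix X Y
  assume X: "X \<in> carrier (braid_group 4)" and Y: "Y \<in> carrier (braid_group 4)"
    and eq: "TL_rep 4 X = TL_rep 4 Y"
  let ?H = "hecke_algebra 4"
  interpret ideal "TL_ideal 4" ?H by (rule ideal_TL_ideal) simp
  have carr: "jones_rep 4 Z \<in> carrier ?H" if "Z \<in> carrier (braid_group 4)" for Z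
    using hom_in_carrier[OF jones_rep_hom that] by (auto simp: units_of_carrier)
  have "jones_rep 4 X \<in> TL_ideal 4 +>\<^bsub>?H\<^esub> jones_rep 4 Y"
    using a_rcos_self[OF carr[OF X]] eq by (simp add: TL_rep_def)
  then obtain t where t: "t \<in> TL_ideal 4" "jones_rep 4 X = t \<oplus>\<^bsub>?H\<^esub> jones_rep 4 Y"
    by (auto simp: a_r_coset_def')
  have "hecke_V31 (jones_rep 4 X) = hecke_V31 t + hecke_V31 (jones_rep 4 Y)"
    using ring_hom_add[OF hecke_V31_hom _ carr[OF Y], of t] t a_Hcarr[OF t(1)]
    by (simp add: matrix_ring_def)
  then have "map_matrix (laurent_eval ratfun_q) (burau_rep X)
      = map_matrix (laurent_eval ratfun_q) (burau_rep Y)"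
    by (simp only: hecke_V31_TL_ideal[OF t(1)] hecke_V31_jones[OF X] hecke_V31_jones[OF Y] add_0)
  then have "burau_rep X = burau_rep Y"
    using injD[OF inj_laurent_eval] by (simp add: vec_eq_iff)
  then show "X = Y"
    using assms X Y by (auto simp: faithful_def inj_on_def)
qed

theorem proposition1p5:
  shows "(faithful (braid_group 4) (jones_rep 4) \<longleftrightarrow> faithful (braid_group 4) (TL_rep 4)) \<and>
         (faithful (braid_group 4) (TL_rep 4) \<longleftrightarrow> faithful (braid_group 4) burau_rep)"
  using faithful_jones_imp_faithful_burau faithful_TL_imp_faithful_jones faithful_burau_imp_faithful_TL
  by blast

end
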